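(* Let $G=\langle s_1,\ldots,s_r\rangle$ be the free group of rank $r$. Let $K$ be a finite set and $\kappa$ a probability measure on $K$. Then $$f(G,K^G,\kappa^G)=H(\kappa).$$
   Context: $K^G$ is the set of all functions $x:G\to K$ with the product Borel structure, $\kappa^G$ is the product measure, and $G$ acts by $(gx)(h)=x(g^{-1}h)$. Here $H(\kappa)=-\sum_{k\in K}\kappa(\{k\})\log\kappa(\{k\})$, with $0\log0=0$. Let $G$ act by measure-preserving transformations on a probability space $(X,\mu)$. A finite partition $\alpha=\{A_1,\dots,A_n\}$ of $X$ is a finite collection of pairwise disjoint measurable sets with union $X$; $g\alpha=\{gA:A\in\alpha\}$ for $g\in G$; the join is $\alpha\vee\beta=\{A\cap B:A\in\alpha,B\in\beta\}$. A partition $\alpha$ is generating if the smallest $G$-invariant $\sigma$-algebra containing $\alpha$ is the $\sigma$-algebra of all measurable sets, up to sets of measure zero. Let $B(e,n)\subset G$ be the ball of radius $n$ centered at the identity $e$ with respect to the word metric induced by $S=\{s_1^{\pm1},\ldots,s_r^{\pm1}\}$. Define $$H(\alpha)=-\sum_{A\in\alpha}\mu(A)\log(\mu(A)),\qquad F(\alpha)=(1-2r)H(\alpha)+\sum_{i=1}^r H(\alpha\vee s_i\alpha),$$ $$\alpha^n=\bigvee_{g\in B(e,n)}g\alpha,\qquad f(\alpha)=\inf_{n\ge 0}F(\alpha^n).$$ The quantity $f(G,X,\mu)$ is defined as $f(\alpha)$ for any finite generating partition $\alpha$ of $X$; this value does not depend on the choice of $\alpha$. (For $(G,K^G,\kappa^G)$,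 the partition $\{A_k : k\in K\}$ with $A_k=\{x\in K^G : x(e)=k\}$ is a finite generating partition.) *)

theory Defs
  imports "HOL-Probability.Probability" "HOL-Algebra.Group"
begin

section \<open>Free groups and word metrics\<close>

definition word_prod :: "('g, 'm) monoid_scheme \<Rightarrow> 'g list \<Rightarrow> 'g" where
  "word_prod G ws = foldr (mult G) ws (one G)"

text \<open>The letter \<open>(i, True)\<close> stands for the generator \<open>s i\<close>, and \<open>(i, False)\<close> for its inverse.\<close>

definition letter :: "('g, 'm) monoid_scheme \<Rightarrow> (nat \<Rightarrow> 'g) \<Rightarrow> nat \<times> bool \<Rightarrow> 'g" where
  "letter G s = (\<lambda>(i, b). if b then s i else m_inv G (s i))"

definition reduced_words :: "nat \<Rightarrow> (nat \<times> bool) list set" where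
  "reduced_words r =
     {ws. set ws \<subseteq> {1..r} \<times> UNIV \<and> successively (\<lambda>(i, b) (j, c). \<not> (i = j \<and> b \<noteq> c)) ws}"

text \<open>
  \<open>G\<close> is free of rank \<open>r\<close> with free generators \<open>s 1, \<dots>, s r\<close>: each element of \<open>G\<close> is
  represented by exactly one reduced word. The values of \<open>s\<close> outside \<open>{1..r}\<close> are irrelevant.
\<close>

definition free_group_on :: "('g, 'm) monoid_scheme \<Rightarrow> nat \<Rightarrow> (nat \<Rightarrow> 'g) \<Rightarrow> bool" where
  "free_group_on G r s \<longleftrightarrow>
     group G \<and> s ` {1..r} \<subseteq> carrier G \<and>
     bij_betw (\<lambda>ws. word_prod G (map (letter G s) ws)) (reduced_words r) (carrier G)"

definition sym_gens :: "('g, 'm) monoid_scheme \<Rightarrow> nat \<Rightarrow> (nat \<Rightarrow> 'g) \<Rightarrow> 'g set" where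
  "sym_gens G r s = s ` {1..r} \<union> (\<lambda>i. m_inv G (s i)) ` {1..r}"

definition word_dist :: "('g, 'm) monoid_scheme \<Rightarrow> 'g set \<Rightarrow> 'g \<Rightarrow> 'g \<Rightarrow> nat" where
  "word_dist G S g h =
     (LEAST n. \<exists>ws. set ws \<subseteq> S \<and> length ws = n \<and> mult G g (word_prod G ws) = h)"

definition word_ball :: "('g, 'm) monoid_scheme \<Rightarrow> 'g set \<Rightarrow> nat \<Rightarrow> 'g set" where
  "word_ball G S n = {g \<in> carrier G. word_dist G S (one G) g \<le> n}"

section \<open>Partitions\<close>

text \<open>
  Below, \<open>T g x\<close> is the action of \<open>g\<close> on the point \<open>x\<close>. A partition may have the empty set as
  a member, so joins need not discard empty intersections.
\<close>

definition finite_partition :: "'x measure \<Rightarrow> 'x set set \<Rightarrow> bool" where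
  "finite_partition M \<alpha> \<longleftrightarrow>
     finite \<alpha> \<and> \<alpha> \<subseteq> sets M \<and> pairwise disjnt \<alpha> \<and> \<Union>\<alpha> = space M"

definition translate :: "('g \<Rightarrow> 'x \<Rightarrow> 'x) \<Rightarrow> 'g \<Rightarrow> 'x set set \<Rightarrow> 'x set set" where
  "translate T g \<alpha> = (\<lambda>A. T g ` A) ` \<alpha>"

definition join :: "'x set set \<Rightarrow> 'x set set \<Rightarrow> 'x set set" where
  "join \<alpha> \<beta> = {A \<inter> B | A B. A \<in> \<alpha> \<and> B \<in> \<beta>}"

definition Join :: "'i set \<Rightarrow> ('i \<Rightarrow> 'x set set) \<Rightarrow> 'x set set" where
  "Join I \<alpha> = {\<Inter>i\<in>I. A i | A. \<forall>i\<in>I. A i \<in> \<alpha> i}"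

definition invariant_sigma ::
  "('g, 'm) monoid_scheme \<Rightarrow> 'x measure \<Rightarrow> ('g \<Rightarrow> 'x \<Rightarrow> 'x) \<Rightarrow> 'x set set \<Rightarrow> 'x set set" where
  "invariant_sigma G M T \<alpha> =
     \<Inter>{\<Sigma>. sigma_algebra (space M) \<Sigma> \<and> \<alpha> \<subseteq> \<Sigma> \<and> (\<forall>g\<in>carrier G. \<forall>A\<in>\<Sigma>. T g ` A \<in> \<Sigma>)}"

definition generating_partition ::
  "('g, 'm) monoid_scheme \<Rightarrow> 'x measure \<Rightarrow> ('g \<Rightarrow> 'x \<Rightarrow> 'x) \<Rightarrow> 'x set set \<Rightarrow> bool" where
  "generating_partition G M T \<alpha> \<longleftrightarrow>
     finite_partition M \<alpha> \<and>
     (\<forall>A\<in>sets M. \<exists>B\<in>invariant_sigma G M T \<alpha>. (A - B) \<union> (B - A) \<in> null_sets M)"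

section \<open>The f-invariant\<close>

definition partition_entropy :: "'x measure \<Rightarrow> 'x set set \<Rightarrow> real" where
  "partition_entropy M \<alpha> = - (\<Sum>A\<in>\<alpha>. measure M A * ln (measure M A))"

definition F_partition ::
  "nat \<Rightarrow> (nat \<Rightarrow> 'g) \<Rightarrow> 'x measure \<Rightarrow> ('g \<Rightarrow> 'x \<Rightarrow> 'x) \<Rightarrow> 'x set set \<Rightarrow> real" where
  "F_partition r s M T \<alpha> =
     (1 - 2 * real r) * partition_entropy M \<alpha>
     + (\<Sum>i=1..r. partition_entropy M (join \<alpha> (translate T (s i) \<alpha>)))"

definition ball_refinement ::
  "('g, 'm) monoid_scheme \<Rightarrow> nat \<Rightarrow> (nat \<Rightarrow> 'g) \<Rightarrow> ('g \<Rightarrow> 'x \<Rightarrow> 'x) \<Rightarrow> 'x set set \<Rightarrow> nat \<Rightarrow> 'x set set"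
  where
  "ball_refinement G r s T \<alpha> n = Join (word_ball G (sym_gens G r s) n) (\<lambda>g. translate T g \<alpha>)"

text \<open>The infimum is taken in the extended reals, since for a general action it can be \<open>-\<infinity>\<close>.\<close>

definition f_partition ::
  "('g, 'm) monoid_scheme \<Rightarrow> nat \<Rightarrow> (nat \<Rightarrow> 'g) \<Rightarrow> 'x measure \<Rightarrow> ('g \<Rightarrow> 'x \<Rightarrow> 'x) \<Rightarrow> 'x set set \<Rightarrow> ereal"
  where
  "f_partition G r s M T \<alpha> = (INF n. ereal (F_partition r s M T (ball_refinement G r s T \<alpha> n)))"

text \<open>
  The common value of \<open>f_partition\<close> on all generating partitions. The description is meaningful
  only if a generating partition exists and the value does not depend on its choice.
\<close>

definition f_invariant ::
  "('g, 'm) monoid_scheme \<Rightarrow> nat \<Rightarrow> (nat \<Rightarrow> 'g) \<Rightarrow> 'x measure \<Rightarrow> ('g \<Rightarrow> 'x \<Rightarrow> 'x) \<Rightarrow> ereal" where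
  "f_invariant G r s M T =
     (THE v. \<exists>\<alpha>. generating_partition G M T \<alpha> \<and> v = f_partition G r s M T \<alpha>)"

section \<open>Bernoulli shifts\<close>

definition bernoulli_measure :: "('g, 'm) monoid_scheme \<Rightarrow> 'k measure \<Rightarrow> ('g \<Rightarrow> 'k) measure" where
  "bernoulli_measure G \<kappa> = (\<Pi>\<^sub>M g\<in>carrier G. \<kappa>)"

definition bernoulli_shift :: "('g, 'm) monoid_scheme \<Rightarrow> 'g \<Rightarrow> ('g \<Rightarrow> 'k) \<Rightarrow> ('g \<Rightarrow> 'k)" where
  "bernoulli_shift G g x = (\<lambda>h\<in>carrier G. x (mult G (m_inv G g) h))"

definition base_entropy :: "'k set \<Rightarrow> 'k measure \<Rightarrow> real" where
  "base_entropy K \<kappa> = - (\<Sum>k\<in>K. measure \<kappa> {k} * ln (measure \<kappa> {k}))"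

end

theory Submission
  imports Defs
begin

text \<open>
  The proof follows Bowen. The value \<open>f_invariant\<close> is described as the common value of
  \<open>f_partition\<close> on all generating partitions, so the proof has two parts: independence of the
  generating partition, and the value on the partition according to the coordinate at the identity.
  Partitions are handled as equivalence relations with finitely many measurable classes.

  Independence rests on two facts. First, \<open>F\<close> does not increase under a splitting, that is, when a
  relation is joined with the translate by a generator of a coarser relation (\<open>F_splitting\<close>); this
  follows from submodularity of entropy. If \<open>R\<close> and \<open>C\<close> are each coarser than a ball refinement of
  the other, then splittings lead from \<open>R\<close> to a ball refinement of \<open>C\<close>, whence \<open>f(C) \<le> F(R)\<close>
  (\<open>F_refine_le_of_equivalent\<close>). Second, if \<open>R\<close> and \<open>C\<close> are merely generating, then an arbitrarily
  small perturbation of \<open>R\<close> brings them into this situation (\<open>ex_equivalent_perturbation\<close>), and the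
  perturbation changes \<open>F\<close> little. Thus \<open>f(C) \<le> F(R)\<close> for all generating \<open>R\<close> and \<open>C\<close>. Since ball
  refinements of \<open>R\<close> are generating too, \<open>f(C) \<le> f(R)\<close>, and equality holds by symmetry.

  For the partition according to the coordinate at the identity, the refinement over a finite set
  \<open>W\<close> of group elements has entropy \<open>card W\<close> times that of the base, so \<open>F\<close> of this refinement is
  the base entropy multiplied by the number of vertices minus the number of edges which \<open>W\<close> spans in
  the Cayley graph. Since the Cayley graph of a free group is a tree, this factor is at least 1
  (\<open>sum_card_edges_less\<close>); for the ball of radius 0 it is at most 1. Hence the infimum over all balls
  is the base entropy.
\<close>

section \<open>Entropy of finite measurable equivalence relations\<close>

text \<open>
  An equivalence relation on the whole space with finitely many classes, all measurable. It stands
  for the partition into its classes: the join of partitions becomes the intersection of relations,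
  and a partition is finer than another if its relation is contained in that of the other. Unlike the
  join of families of sets, the intersection is idempotent; empty cells are never recorded.
\<close>

definition meas_equiv :: "'x measure \<Rightarrow> ('x \<times> 'x) set \<Rightarrow> bool" where
  "meas_equiv M R \<longleftrightarrow>
     equiv (space M) R \<and> finite (space M // R) \<and> space M // R \<subseteq> sets M"

text \<open>
  The entropy of the partition of the space into the classes of \<open>R\<close>.
\<close>

definition equiv_entropy :: "'x measure \<Rightarrow> ('x \<times> 'x) set \<Rightarrow> real" where
  "equiv_entropy M R = partition_entropy M (space M // R)"

lemma meas_equivD:
  assumes "meas_equiv M R"
  shows "equiv (space M) R" "finite (space M // R)" "\<And>C. C \<in> space M // R \<Longrightarrow> C \<in> sets M"
    and "R \<subseteq> space M \<times> space M"
    and "\<And>x. x \<in> space M \<Longrightarrow> (x, x) \<in> R"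
    and "\<And>x y. (x, y) \<in> R \<Longrightarrow> (y, x) \<in> R"
    and "\<And>x y z. (x, y) \<in> R \<Longrightarrow> (y, z) \<in> R \<Longrightarrow> (x, z) \<in> R"
proof -
  have R: "equiv (space M) R" using assms by (simp add: meas_equiv_def)
  show "equiv (space M) R" by (fact R)
  show "finite (space M // R)" "\<And>C. C \<in> space M // R \<Longrightarrow> C \<in> sets M"
    using assms by (auto simp: meas_equiv_def)
  show "R \<subseteq> space M \<times> space M" using R by (rule equiv_type)
  show "\<And>x. x \<in> space M \<Longrightarrow> (x, x) \<in> R" using R by (meson equivE refl_onD)
  show "\<And>x y. (x, y) \<in> R \<Longrightarrow> (y, x) \<in> R" using R by (meson equivE symD)
  show "\<And>x y z. (x, y) \<in> R \<Longrightarrow> (y, z) \<in> R \<Longrightarrow> (x, z) \<in> R" using R by (meson equivE transD)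
qed

lemma equiv_Image_class:
  assumes "equiv X Q" "equiv X R" "Q \<subseteq> R" "x \<in> X"
  shows "R `` (Q `` {x}) = R `` {x}"
proof
  show "R `` (Q `` {x}) \<subseteq> R `` {x}"
    using assms(2,3) by (auto elim!: equivE dest: transD)
  show "R `` {x} \<subseteq> R `` (Q `` {x})"
    using equiv_class_self[OF assms(1,4)] by auto
qed

lemma equiv_Image_in_quotient:
  assumes "equiv X Q" "equiv X R" "Q \<subseteq> R" "D \<in> X // Q"
  shows "R `` D \<in> X // R" "D \<subseteq> R `` D"
proof -
  obtain x where x: "x \<in> X" "D = Q `` {x}" using assms(4) by (rule quotientE)
  show "R `` D \<in> X // R" using equiv_Image_class[OF assms(1-3) x(1)] x by (simp add: quotientI)
  show "D \<subseteq> R `` D" using equiv_Image_class[OF assms(1-3) x(1)] x assms(3) by auto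
qed

lemma equiv_class_unique:
  assumes "equiv X R" "C \<in> X // R" "x \<in> C"
  shows "R `` {x} = C" "x \<in> X"
proof -
  obtain y where "y \<in> X" "C = R `` {y}" using assms(2) by (rule quotientE)
  then show "R `` {x} = C" "x \<in> X"
    using assms(1,3) by (auto simp: equiv_class_eq_iff[OF assms(1)])
qed

lemma equiv_class_eq_Union_fibre:
  assumes "equiv X Q" "equiv X R" "Q \<subseteq> R" "C \<in> X // R"
  shows "\<Union>{D \<in> X // Q. R `` D = C} = C"
proof
  show "\<Union>{D \<in> X // Q. R `` D = C} \<subseteq> C"
    using equiv_Image_in_quotient(2)[OF assms(1-3)] by blast
  show "C \<subseteq> \<Union>{D \<in> X // Q. R `` D = C}"
  proof
    fix x assume "x \<in> C"
    note x = equiv_class_unique[OF assms(2,4) this]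
    then have "R `` (Q `` {x}) = C" using equiv_Image_class[OF assms(1-3)] by simp
    then show "x \<in> \<Union>{D \<in> X // Q. R `` D = C}"
      using x equiv_class_self[OF assms(1) x(2)] by (intro UnionI[of "Q `` {x}"]) (auto simp: quotientI)
  qed
qed

lemma quotient_eqI:
  assumes "equiv X R" "C \<in> X // R" "D \<in> X // R" "x \<in> C" "x \<in> D"
  shows "C = D"
  using equiv_class_unique(1)[OF assms(1,2,4)] equiv_class_unique(1)[OF assms(1,3,5)] by simp

context prob_space
begin

lemma measure_eq_sum_classes:
  assumes "meas_equiv M Q" "\<D> \<subseteq> space M // Q"
  shows "prob (\<Union>\<D>) = (\<Sum>D\<in>\<D>. prob D)"
proof -
  note Q = meas_equivD[OF assms(1)]
  have "prob (\<Union>D\<in>\<D>. D) = (\<Sum>D\<in>\<D>. prob D)"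
  proof (rule finite_measure_finite_Union)
    show "finite \<D>" using Q(2) assms(2) finite_subset by blast
    show "(\<lambda>D. D) ` \<D> \<subseteq> events" using Q(3) assms(2) by auto
    show "disjoint_family_on (\<lambda>D. D) \<D>"
      using assms(2) quotient_eqI[OF Q(1)] unfolding disjoint_family_on_def by blast
  qed
  then show ?thesis by simp
qed

lemma meas_equiv_coarser:
  assumes Q: "meas_equiv M Q" and R: "equiv (space M) R" and "Q \<subseteq> R"
  shows "meas_equiv M R"
proof -
  note Q' = meas_equivD[OF Q]
  have cls: "C = \<Union>{D \<in> space M // Q. R `` D = C}" if "C \<in> space M // R" for C
    using equiv_class_eq_Union_fibre[OF Q'(1) R assms(3) that] by simp
  have "space M // R \<subseteq> Union ` Pow (space M // Q)"
  proof
    fix C assume "C \<in> space M // R"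
    from cls[OF this] show "C \<in> Union ` Pow (space M // Q)" by blast
  qed
  moreover have "finite (Union ` Pow (space M // Q))" using Q'(2) by simp
  moreover have "Union ` Pow (space M // Q) \<subseteq> sets M"
  proof clarify
    fix \<D> assume "\<D> \<subseteq> space M // Q"
    then show "\<Union>\<D> \<in> sets M"
      using Q'(2,3) by (intro sets.finite_Union) (auto intro: finite_subset)
  qed
  ultimately show ?thesis
    using R unfolding meas_equiv_def by (blast intro: finite_subset)
qed

lemma meas_equiv_Int:
  assumes R: "meas_equiv M R" and S: "meas_equiv M S"
  shows "meas_equiv M (R \<inter> S)"
proof -
  note R' = meas_equivD[OF R] and S' = meas_equivD[OF S]
  let ?I = "(\<lambda>(C, D). C \<inter> D) ` ((space M // R) \<times> (space M // S))"
  have "equiv (space M) (R \<inter> S)"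
  proof (rule equivI)
    show "R \<inter> S \<subseteq> space M \<times> space M" using R'(4) by blast
    show "refl_on (space M) (R \<inter> S)" using R'(5) S'(5) by (simp add: refl_on_def)
    show "sym (R \<inter> S)" using R'(6) S'(6) by (simp add: sym_def)
    show "trans (R \<inter> S)" using R'(7) S'(7) unfolding trans_def by blast
  qed
  moreover have "space M // (R \<inter> S) \<subseteq> ?I"
  proof
    fix C assume "C \<in> space M // (R \<inter> S)"
    then obtain x where "x \<in> space M" "C = (R \<inter> S) `` {x}" by (rule quotientE)
    then show "C \<in> ?I" by (auto intro!: image_eqI[of _ _ "(R `` {x}, S `` {x})"] quotientI)
  qed
  moreover have "finite ?I" using R'(2) S'(2) by simp
  moreover have "?I \<subseteq> sets M" using R'(3) S'(3) by auto
  ultimately show ?thesis unfolding meas_equiv_def by (blast intro: finite_subset)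
qed

text \<open>
  Sums over classes may be computed over the classes of any finer relation. This allows
  entropies of several relations to be compared term by term.
\<close>

lemma sum_classes_finer:
  fixes g :: "'a set \<Rightarrow> real"
  assumes Q: "meas_equiv M Q" and R: "meas_equiv M R" and "Q \<subseteq> R"
  shows "(\<Sum>C\<in>space M // R. prob C * g C) = (\<Sum>D\<in>space M // Q. prob D * g (R `` D))"
proof -
  note Q' = meas_equivD[OF Q] and R' = meas_equivD[OF R]
  have "(\<Sum>C\<in>space M // R. prob C * g C)
      = (\<Sum>C\<in>space M // R. \<Sum>D\<in>{D \<in> space M // Q. R `` D = C}. prob D * g (R `` D))"
  proof (rule sum.cong[OF refl])
    fix C assume C: "C \<in> space M // R"
    have "prob C = (\<Sum>D\<in>{D \<in> space M // Q. R `` D = C}. prob D)"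
      using measure_eq_sum_classes[OF Q, of "{D \<in> space M // Q. R `` D = C}"]
        equiv_class_eq_Union_fibre[OF Q'(1) R'(1) assms(3) C] by simp
    then show "prob C * g C = (\<Sum>D\<in>{D \<in> space M // Q. R `` D = C}. prob D * g (R `` D))"
      by (simp add: sum_distrib_right)
  qed
  also have "\<dots> = (\<Sum>D\<in>space M // Q. prob D * g (R `` D))"
    using Q'(2) R'(2) equiv_Image_in_quotient(1)[OF Q'(1) R'(1) assms(3)]
    by (intro sum.group) auto
  finally show ?thesis .
qed

lemma equiv_entropy_finer:
  assumes "meas_equiv M Q" "meas_equiv M R" "Q \<subseteq> R"
  shows "equiv_entropy M R = - (\<Sum>D\<in>space M // Q. prob D * ln (prob (R `` D)))"
  unfolding equiv_entropy_def partition_entropy_def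
  using sum_classes_finer[OF assms, of "\<lambda>C. ln (prob C)"] by simp

lemma measure_class_mono:
  assumes "meas_equiv M Q" "meas_equiv M R" "Q \<subseteq> R" "D \<in> space M // Q"
  shows "prob D \<le> prob (R `` D)"
  using equiv_Image_in_quotient[OF meas_equivD(1)[OF assms(1)] meas_equivD(1)[OF assms(2)] assms(3,4)]
    meas_equivD(3)[OF assms(2)] by (intro finite_measure_mono) auto

lemma equiv_entropy_mono:
  assumes "meas_equiv M Q" "meas_equiv M R" "Q \<subseteq> R"
  shows "equiv_entropy M R \<le> equiv_entropy M Q"
proof -
  have "prob D * ln (prob D) \<le> prob D * ln (prob (R `` D))" if "D \<in> space M // Q" for D
  proof (cases "prob D = 0")
    case False
    then have "0 < prob D" by (simp add: less_le)
    then show ?thesis using measure_class_mono[OF assms that] by (intro mult_left_mono) auto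
  qed simp
  then show ?thesis
    unfolding equiv_entropy_finer[OF assms]
    by (simp add: equiv_entropy_def partition_entropy_def sum_mono)
qed

text \<open>
  Nonnegativity of conditional mutual information: given \<open>U\<close>, the relations \<open>R\<close> and \<open>S\<close> together
  carry at most the sum of their separate information.
\<close>

lemma equiv_entropy_submodular:
  assumes R: "meas_equiv M R" and S: "meas_equiv M S" and U: "meas_equiv M U"
  shows "equiv_entropy M (R \<inter> S \<inter> U) + equiv_entropy M U
       \<le> equiv_entropy M (R \<inter> U) + equiv_entropy M (S \<inter> U)"
proof -
  define Q RU SU where "Q = R \<inter> S \<inter> U" and "RU = R \<inter> U" and "SU = S \<inter> U"
  have Q: "meas_equiv M Q" and RU: "meas_equiv M RU" and SU: "meas_equiv M SU"
    unfolding Q_def RU_def SU_def by (intro meas_equiv_Int R S U)+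
  note mQ = meas_equivD[OF Q] and mU = meas_equivD[OF U]
    and mRU = meas_equivD[OF RU] and mSU = meas_equivD[OF SU]
  have sub: "Q \<subseteq> U" "Q \<subseteq> RU" "Q \<subseteq> SU" "Q \<subseteq> Q" "RU \<subseteq> U" "SU \<subseteq> U"
    unfolding Q_def RU_def SU_def by auto
  let ?X = "space M"
  have entQ: "equiv_entropy M Q = - (\<Sum>D\<in>?X // Q. prob D * ln (prob D))"
    by (simp add: equiv_entropy_def partition_entropy_def)
  define w where "w D = prob (RU `` D) * prob (SU `` D) / prob (U `` D)" for D
  have "equiv_entropy M Q + equiv_entropy M U - (equiv_entropy M RU + equiv_entropy M SU)
      = (\<Sum>D\<in>?X // Q. prob D * (ln (prob (RU `` D)) + ln (prob (SU `` D))
            - ln (prob D) - ln (prob (U `` D))))"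
    unfolding entQ equiv_entropy_finer[OF Q U sub(1)] equiv_entropy_finer[OF Q RU sub(2)]
      equiv_entropy_finer[OF Q SU sub(3)]
    by (simp add: sum.distrib sum_subtractf algebra_simps)
  also have "\<dots> \<le> (\<Sum>D\<in>?X // Q. w D - prob D)"
  proof (rule sum_mono)
    fix D assume D: "D \<in> ?X // Q"
    show "prob D * (ln (prob (RU `` D)) + ln (prob (SU `` D)) - ln (prob D) - ln (prob (U `` D)))
        \<le> w D - prob D"
    proof (cases "prob D = 0")
      case False
      then have p: "0 < prob D" by (simp add: less_le)
      have p1: "0 < prob (RU `` D)" using measure_class_mono[OF Q RU sub(2) D] p by linarith
      have p2: "0 < prob (SU `` D)" using measure_class_mono[OF Q SU sub(3) D] p by linarith
      have p3: "0 < prob (U `` D)" using measure_class_mono[OF Q U sub(1) D] p by linarith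
      have "ln (prob (RU `` D)) + ln (prob (SU `` D)) - ln (prob D) - ln (prob (U `` D))
          = ln (w D / prob D)"
        using p p1 p2 p3 by (simp add: w_def ln_mult ln_div)
      \<comment> \<open>As in Gibbs' inequality; the weights \<open>w D\<close> have total mass at most 1.\<close>
      also have "\<dots> \<le> w D / prob D - 1"
        using p p1 p2 p3 by (intro ln_le_minus_one) (simp add: w_def)
      finally show ?thesis using p by (simp add: field_simps)
    qed (simp add: w_def)
  qed
  also have "\<dots> = (\<Sum>D\<in>?X // Q. w D) - 1"
  proof -
    have "(\<Sum>D\<in>?X // Q. prob D) = prob (\<Union>(?X // Q))"
      using measure_eq_sum_classes[OF Q order_refl] by simp
    then show ?thesis by (simp add: sum_subtractf Union_quotient[OF mQ(1)] prob_space)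
  qed
  also have "(\<Sum>D\<in>?X // Q. w D) \<le> 1"
  proof -
    let ?P = "Sigma (?X // RU) (\<lambda>A. {B \<in> ?X // SU. U `` B = U `` A})"
    define v where "v = (\<lambda>(A, B). prob A * prob B / prob (U `` A))"
    define pair where "pair D = (RU `` D, SU `` D)" for D
    have UU: "U `` (RU `` D) = U `` D" "U `` (SU `` D) = U `` D" if "D \<in> ?X // Q" for D
    proof -
      obtain x where x: "x \<in> ?X" "D = Q `` {x}" using \<open>D \<in> ?X // Q\<close> by (rule quotientE)
      show "U `` (RU `` D) = U `` D" "U `` (SU `` D) = U `` D"
        using x equiv_Image_class[OF mQ(1) mRU(1) sub(2) x(1)] equiv_Image_class[OF mQ(1) mSU(1) sub(3) x(1)]
          equiv_Image_class[OF mQ(1) mU(1) sub(1) x(1)] equiv_Image_class[OF mRU(1) mU(1) sub(5) x(1)]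
          equiv_Image_class[OF mSU(1) mU(1) sub(6) x(1)] by auto
    qed
    have inj: "inj_on pair (?X // Q)"
    proof (rule inj_onI)
      fix D D' assume D: "D \<in> ?X // Q" and D': "D' \<in> ?X // Q" and eq: "pair D = pair D'"
      obtain x where x: "x \<in> ?X" "D = Q `` {x}" using D by (rule quotientE)
      obtain y where y: "y \<in> ?X" "D' = Q `` {y}" using D' by (rule quotientE)
      have "RU `` {x} = RU `` {y}" "SU `` {x} = SU `` {y}"
        using eq x y equiv_Image_class[OF mQ(1) mRU(1) sub(2)] equiv_Image_class[OF mQ(1) mSU(1) sub(3)]
        by (auto simp: pair_def)
      then have "(x, y) \<in> RU" "(x, y) \<in> SU"
        using x y eq_equiv_class_iff[OF mRU(1)] eq_equiv_class_iff[OF mSU(1)] by auto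
      then have "(x, y) \<in> Q" by (auto simp: Q_def RU_def SU_def)
      then show "D = D'" using x y equiv_class_eq[OF mQ(1)] by simp
    qed
    have im: "pair ` (?X // Q) \<subseteq> ?P"
    proof (rule image_subsetI)
      fix D assume D: "D \<in> ?X // Q"
      show "pair D \<in> ?P"
        using equiv_Image_in_quotient(1)[OF mQ(1) mRU(1) sub(2) D]
          equiv_Image_in_quotient(1)[OF mQ(1) mSU(1) sub(3) D] UU[OF D] by (simp add: pair_def)
    qed
    have fin: "finite ?P" using mRU(2) mSU(2) by (intro finite_SigmaI) auto
    have "(\<Sum>D\<in>?X // Q. w D) = (\<Sum>D\<in>?X // Q. v (pair D))"
      by (intro sum.cong) (auto simp: w_def v_def pair_def UU)
    also have "\<dots> = sum v (pair ` (?X // Q))"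
      using inj by (simp add: sum.reindex)
    also have "\<dots> \<le> sum v ?P"
      using fin im by (intro sum_mono2) (auto simp: v_def)
    also have "\<dots> = (\<Sum>A\<in>?X // RU. \<Sum>B\<in>{B \<in> ?X // SU. U `` B = U `` A}. prob A / prob (U `` A) * prob B)"
      unfolding v_def using mRU(2) mSU(2) by (subst sum.Sigma) (auto simp: split_beta)
    also have "\<dots> = (\<Sum>A\<in>?X // RU. prob A / prob (U `` A) * prob (U `` A))"
    proof (rule sum.cong[OF refl])
      fix A assume A: "A \<in> ?X // RU"
      have UA: "U `` A \<in> ?X // U" using equiv_Image_in_quotient(1)[OF mRU(1) mU(1) sub(5) A] .
      have "(\<Sum>B\<in>{B \<in> ?X // SU. U `` B = U `` A}. prob B) = prob (U `` A)"
        using measure_eq_sum_classes[OF SU, of "{B \<in> ?X // SU. U `` B = U `` A}"]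
          equiv_class_eq_Union_fibre[OF mSU(1) mU(1) sub(6) UA] by simp
      then show "(\<Sum>B\<in>{B \<in> ?X // SU. U `` B = U `` A}. prob A / prob (U `` A) * prob B)
          = prob A / prob (U `` A) * prob (U `` A)"
        by (simp only: sum_distrib_left[symmetric])
    qed
    also have "\<dots> \<le> (\<Sum>A\<in>?X // RU. prob A)"
      by (intro sum_mono) simp
    also have "\<dots> = prob (\<Union>(?X // RU))"
      using measure_eq_sum_classes[OF RU order_refl] by simp
    also have "\<dots> = 1" by (simp add: Union_quotient[OF mRU(1)] prob_space)
    finally show ?thesis .
  qed
  finally show ?thesis unfolding Q_def RU_def SU_def by simp
qed

end

section \<open>Measure preserving actions and the splitting inequality\<close>

text \<open>
  An action of the group \<open>G\<close> by measure preserving transformations of a probability space.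
\<close>

locale pmp_action = prob_space M + group G
  for M :: "'x measure" and G :: "('g, 'm) monoid_scheme" (structure) +
  fixes T :: "'g \<Rightarrow> 'x \<Rightarrow> 'x"
  assumes T_measurable: "g \<in> carrier G \<Longrightarrow> T g \<in> measurable M M"
    and T_distr: "g \<in> carrier G \<Longrightarrow> distr M M (T g) = M"
    and T_one: "x \<in> space M \<Longrightarrow> T \<one> x = x"
    and T_mult: "g \<in> carrier G \<Longrightarrow> h \<in> carrier G \<Longrightarrow> x \<in> space M \<Longrightarrow> T (g \<otimes> h) x = T g (T h x)"
begin

lemma T_closed: "g \<in> carrier G \<Longrightarrow> x \<in> space M \<Longrightarrow> T g x \<in> space M"
  using T_measurable by (meson measurable_space)

lemma T_inv:
  assumes "g \<in> carrier G" "x \<in> space M"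
  shows "T (inv g) (T g x) = x" "T g (T (inv g) x) = x"
  using T_mult[of "inv g" g x] T_mult[of g "inv g" x] assms by (simp_all add: T_one)

lemma T_image_eq:
  assumes "g \<in> carrier G" "A \<subseteq> space M"
  shows "T g ` A = T (inv g) -` A \<inter> space M"
proof safe
  fix x assume "x \<in> A"
  then show "T g x \<in> space M" "T g x \<in> T (inv g) -` A" using assms by (auto simp: T_inv T_closed)
next
  fix y assume "T (inv g) y \<in> A" "y \<in> space M"
  then show "y \<in> T g ` A" using assms T_inv(2)[of g y] by (auto intro!: image_eqI[of _ _ "T (inv g) y"])
qed

lemma T_image_sets:
  assumes "g \<in> carrier G" "A \<in> sets M"
  shows "T g ` A \<in> sets M" "prob (T g ` A) = prob A"
proof -
  note eq = T_image_eq[OF assms(1) sets.sets_into_space[OF assms(2)]]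
  have i: "inv g \<in> carrier G" using assms(1) by simp
  show "T g ` A \<in> sets M" unfolding eq using T_measurable[OF i] assms(2) by (rule measurable_sets)
  show "prob (T g ` A) = prob A"
    unfolding eq using measure_distr[OF T_measurable[OF i] assms(2)] T_distr[OF i] by simp
qed

text \<open>
  \<open>shift_rel g R\<close> is the image of \<open>R\<close> under \<open>T g\<close>; its classes are the translates by \<open>g\<close> of
  the classes of \<open>R\<close>. The relation \<open>refine R W\<close> is the common refinement of the relations
  \<open>shift_rel g R\<close> for \<open>g \<in> W\<close>.
\<close>

definition shift_rel :: "'g \<Rightarrow> ('x \<times> 'x) set \<Rightarrow> ('x \<times> 'x) set" where
  "shift_rel g R = {(x, y) \<in> space M \<times> space M. (T (inv g) x, T (inv g) y) \<in> R}"

definition refine :: "('x \<times> 'x) set \<Rightarrow> 'g set \<Rightarrow> ('x \<times> 'x) set" where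
  "refine R W = {(x, y) \<in> space M \<times> space M. \<forall>g\<in>W. (T (inv g) x, T (inv g) y) \<in> R}"

lemma shift_rel_Int: "shift_rel g (R \<inter> S) = shift_rel g R \<inter> shift_rel g S"
  by (auto simp: shift_rel_def)

lemma shift_rel_mono: "R \<subseteq> S \<Longrightarrow> shift_rel g R \<subseteq> shift_rel g S"
  by (auto simp: shift_rel_def)

lemma shift_rel_shift_rel:
  assumes "g \<in> carrier G" "h \<in> carrier G"
  shows "shift_rel g (shift_rel h R) = shift_rel (g \<otimes> h) R"
  using assms by (auto simp: shift_rel_def inv_mult_group T_mult T_closed)

lemma shift_rel_one: "R \<subseteq> space M \<times> space M \<Longrightarrow> shift_rel \<one> R = R"
  by (auto simp: shift_rel_def T_one)

lemma refine_insert: "refine R (insert g W) = shift_rel g R \<inter> refine R W"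
  by (auto simp: refine_def shift_rel_def)

lemma refine_empty: "refine R {} = space M \<times> space M"
  by (auto simp: refine_def)

lemma refine_Un: "refine R (V \<union> W) = refine R V \<inter> refine R W"
  by (auto simp: refine_def)

lemma refine_mono: "R \<subseteq> S \<Longrightarrow> W \<subseteq> V \<Longrightarrow> refine R V \<subseteq> refine S W"
  by (auto simp: refine_def)

lemma refine_subset:
  assumes "R \<subseteq> space M \<times> space M" "\<one> \<in> W"
  shows "refine R W \<subseteq> R"
  using refine_insert[of R \<one> W] shift_rel_one[OF assms(1)] assms(2) by (auto simp: insert_absorb)

lemma refine_refine:
  assumes "V \<subseteq> carrier G" "W \<subseteq> carrier G"
  shows "refine (refine R V) W = refine R {w \<otimes> v | w v. w \<in> W \<and> v \<in> V}"
proof -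
  have "(\<forall>w\<in>W. (T (inv w) x, T (inv w) y) \<in> refine R V)
      \<longleftrightarrow> (\<forall>w\<in>W. \<forall>v\<in>V. (T (inv (w \<otimes> v)) x, T (inv (w \<otimes> v)) y) \<in> R)"
    if "x \<in> space M" "y \<in> space M" for x y
  proof -
    have "(T (inv w) x, T (inv w) y) \<in> refine R V
        \<longleftrightarrow> (\<forall>v\<in>V. (T (inv (w \<otimes> v)) x, T (inv (w \<otimes> v)) y) \<in> R)" if "w \<in> W" for w
    proof -
      have w: "w \<in> carrier G" using that assms by auto
      have "T (inv (w \<otimes> v)) z = T (inv v) (T (inv w) z)" if "v \<in> V" "z \<in> space M" for v z
        using that assms w by (subst inv_mult_group) (auto intro!: T_mult)
      then show ?thesis
        using \<open>x \<in> space M\<close> \<open>y \<in> space M\<close> w by (simp add: refine_def T_closed)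
    qed
    then show ?thesis by simp
  qed
  then show ?thesis 
    unfolding refine_def[of "refine R V" W] refine_def[of R "{w \<otimes> v | w v. w \<in> W \<and> v \<in> V}"] by blast
qed

lemma quotient_shift_rel:
  assumes "g \<in> carrier G" "R \<subseteq> space M \<times> space M"
  shows "space M // shift_rel g R = (\<lambda>A. T g ` A) ` (space M // R)"
proof -
  have cls: "shift_rel g R `` {T g x} = T g ` (R `` {x})" if "x \<in> space M" for x
  proof -
    have "R `` {x} \<subseteq> space M" using assms(2) by auto
    then show ?thesis
      unfolding T_image_eq[OF assms(1) \<open>R `` {x} \<subseteq> space M\<close>]
      using assms(1) that by (auto simp: shift_rel_def T_inv T_closed)
  qed
  have sp: "T g ` space M = space M"
    using T_image_eq[OF assms(1) order_refl] assms(1) by (auto simp: T_closed)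
  have "space M // shift_rel g R = (\<lambda>x. shift_rel g R `` {x}) ` space M"
    by (auto simp: quotient_def)
  also have "\<dots> = (\<lambda>x. shift_rel g R `` {x}) ` (T g ` space M)"
    by (simp only: sp)
  also have "\<dots> = (\<lambda>x. T g ` (R `` {x})) ` space M"
    unfolding image_image by (intro image_cong refl cls)
  also have "\<dots> = (\<lambda>A. T g ` A) ` (space M // R)"
    by (auto simp: quotient_def)
  finally show ?thesis .
qed

lemma inj_on_T_image: "g \<in> carrier G \<Longrightarrow> inj_on (\<lambda>A. T g ` A) (Pow (space M))"
  by (intro inj_on_image_Pow inj_on_inverseI[of _ "T (inv g)"]) (simp add: T_inv)

lemma equiv_shift_rel:
  assumes "g \<in> carrier G" "equiv (space M) R"
  shows "equiv (space M) (shift_rel g R)"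
proof (rule equivI)
  show "shift_rel g R \<subseteq> space M \<times> space M" by (auto simp: shift_rel_def)
  show "refl_on (space M) (shift_rel g R)"
    using assms by (auto simp: refl_on_def shift_rel_def T_closed elim!: equivE)
  show "sym (shift_rel g R)"
    using assms by (auto simp: sym_def shift_rel_def elim!: equivE)
  show "trans (shift_rel g R)"
  proof (rule transI)
    fix x y z assume "(x, y) \<in> shift_rel g R" "(y, z) \<in> shift_rel g R"
    moreover have "trans R" using assms(2) by (rule equivE)
    ultimately show "(x, z) \<in> shift_rel g R"
      unfolding shift_rel_def by (blast dest: transD)
  qed
qed

lemma meas_equiv_shift_rel:
  assumes "g \<in> carrier G" "meas_equiv M R"
  shows "meas_equiv M (shift_rel g R)"
proof -
  note R = meas_equivD[OF assms(2)]
  show ?thesis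
    unfolding meas_equiv_def quotient_shift_rel[OF assms(1) R(4)]
    using equiv_shift_rel[OF assms(1) R(1)] R(2) T_image_sets(1)[OF assms(1) R(3)] by auto
qed

lemma equiv_entropy_shift_rel:
  assumes "g \<in> carrier G" "meas_equiv M R"
  shows "equiv_entropy M (shift_rel g R) = equiv_entropy M R"
proof -
  note R = meas_equivD[OF assms(2)]
  have "inj_on (\<lambda>A. T g ` A) (space M // R)"
    using inj_on_T_image[OF assms(1)] by (rule inj_on_subset) (auto dest: R(3) sets.sets_into_space)
  then show ?thesis
    unfolding equiv_entropy_def partition_entropy_def quotient_shift_rel[OF assms(1) R(4)]
    by (simp add: sum.reindex T_image_sets(2)[OF assms(1)] R(3))
qed

lemma meas_equiv_UNIV: "meas_equiv M (space M \<times> space M)"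
proof -
  have "equiv (space M) (space M \<times> space M)"
    by (intro equivI) (auto simp: refl_on_def sym_def trans_def)
  moreover have "space M // (space M \<times> space M) \<subseteq> {space M}"
    unfolding quotient_def by auto
  ultimately show ?thesis
    unfolding meas_equiv_def using finite_subset by auto
qed

lemma meas_equiv_refine:
  assumes "finite W" "W \<subseteq> carrier G" "meas_equiv M R"
  shows "meas_equiv M (refine R W)"
  using assms
  by (induction W rule: finite_induct)
     (auto simp: refine_empty refine_insert intro!: meas_equiv_UNIV meas_equiv_Int meas_equiv_shift_rel)

text \<open>
  The entropy that \<open>D\<close> adds to \<open>V\<close> is at most the entropy that it adds to any coarser relation \<open>R\<close>.
\<close>

lemma equiv_entropy_Int_cond:
  assumes "meas_equiv M V" "meas_equiv M D" "meas_equiv M R" "V \<subseteq> R"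
  shows "equiv_entropy M (V \<inter> D) \<le> equiv_entropy M V + (equiv_entropy M (R \<inter> D) - equiv_entropy M R)"
proof -
  have "V \<inter> D \<inter> R = V \<inter> D" "V \<inter> R = V" "D \<inter> R = R \<inter> D" using assms(4) by auto
  then show ?thesis using equiv_entropy_submodular[OF assms(1,2,3)] by simp
qed

end

text \<open>
  The group is generated by \<open>s 1, \<dots>, s r\<close>, not necessarily freely.
\<close>

locale finitely_generated_action = pmp_action M G T
  for M :: "'x measure" and G :: "('g, 'm) monoid_scheme" (structure) and T :: "'g \<Rightarrow> 'x \<Rightarrow> 'x" +
  fixes r :: nat and s :: "nat \<Rightarrow> 'g"
  assumes gens: "s ` {1..r} \<subseteq> carrier G"
    and gens_generate: "g \<in> carrier G \<Longrightarrow> \<exists>ws. set ws \<subseteq> sym_gens G r s \<and> word_prod G ws = g"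
begin

text \<open>
  The counterpart of \<open>F_partition\<close> for equivalence relations; see \<open>F_partition_same_cell\<close>.
\<close>

definition F :: "('x \<times> 'x) set \<Rightarrow> real" where
  "F R = (1 - 2 * real r) * equiv_entropy M R
    + (\<Sum>i=1..r. equiv_entropy M (R \<inter> shift_rel (s i) R))"

abbreviation ball where "ball \<equiv> word_ball G (sym_gens G r s)"

lemma gen_closed: "i \<in> {1..r} \<Longrightarrow> s i \<in> carrier G"
  using gens by auto

lemma sym_gens_closed: "sym_gens G r s \<subseteq> carrier G"
  using gens by (auto simp: sym_gens_def)

lemma word_prod_closed: "set ws \<subseteq> sym_gens G r s \<Longrightarrow> word_prod G ws \<in> carrier G"
  using sym_gens_closed by (induction ws) (auto simp: word_prod_def)

lemma word_prod_append:
  "set us \<subseteq> sym_gens G r s \<Longrightarrow> set vs \<subseteq> sym_gens G r s \<Longrightarrow>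
    word_prod G (us @ vs) = word_prod G us \<otimes> word_prod G vs"
proof (induction us)
  case Nil
  then show ?case using word_prod_closed[of vs] by (simp add: word_prod_def)
next
  case (Cons u us)
  then show ?case using word_prod_closed[of us] word_prod_closed[of vs] sym_gens_closed
    by (auto simp: word_prod_def m_assoc)
qed

lemma ball_eq: "ball n = {word_prod G ws | ws. set ws \<subseteq> sym_gens G r s \<and> length ws \<le> n}"
proof safe
  fix g assume "g \<in> ball n"
  then have g: "g \<in> carrier G" and le: "word_dist G (sym_gens G r s) \<one> g \<le> n"
    by (auto simp: word_ball_def)
  obtain ws where "set ws \<subseteq> sym_gens G r s" "word_prod G ws = g" using gens_generate[OF g] by blast
  then have "\<exists>n ws. set ws \<subseteq> sym_gens G r s \<and> length ws = n \<and> \<one> \<otimes> word_prod G ws = g"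
    using g by auto
  from LeastI_ex[OF this] obtain vs where
    "set vs \<subseteq> sym_gens G r s" "length vs = word_dist G (sym_gens G r s) \<one> g"
    "\<one> \<otimes> word_prod G vs = g" unfolding word_dist_def by blast
  then show "\<exists>ws. g = word_prod G ws \<and> set ws \<subseteq> sym_gens G r s \<and> length ws \<le> n"
    using le word_prod_closed[of vs] by (intro exI[of _ vs]) auto
next
  fix ws assume ws: "set ws \<subseteq> sym_gens G r s" "length ws \<le> n"
  then have "word_dist G (sym_gens G r s) \<one> (word_prod G ws) \<le> length ws"
    unfolding word_dist_def using word_prod_closed[of ws] by (intro Least_le) auto
  then show "word_prod G ws \<in> ball n" using ws word_prod_closed by (simp add: word_ball_def)
qed

lemma finite_ball: "finite (ball n)"
proof -
  have "finite (sym_gens G r s)" by (simp add: sym_gens_def)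
  then have "finite {ws. set ws \<subseteq> sym_gens G r s \<and> length ws \<le> n}" by (rule finite_lists_length_le)
  moreover have "ball n = word_prod G ` {ws. set ws \<subseteq> sym_gens G r s \<and> length ws \<le> n}"
    unfolding ball_eq by auto
  ultimately show ?thesis by simp
qed

lemma ball_closed: "ball n \<subseteq> carrier G"
  by (auto simp: word_ball_def)

lemma ball_0: "ball 0 = {\<one>}"
  unfolding ball_eq by (auto simp: word_prod_def)

lemma ball_mono: "m \<le> n \<Longrightarrow> ball m \<subseteq> ball n"
  unfolding word_ball_def by auto

lemma one_in_ball: "\<one> \<in> ball n"
  using ball_mono[of 0 n] ball_0 by auto

lemma ball_mult: "{g \<otimes> h | g h. g \<in> ball m \<and> h \<in> ball n} \<subseteq> ball (m + n)"
proof safe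
  fix g h assume "g \<in> ball m" "h \<in> ball n"
  then obtain us vs where "set us \<subseteq> sym_gens G r s" "length us \<le> m" "g = word_prod G us"
    "set vs \<subseteq> sym_gens G r s" "length vs \<le> n" "h = word_prod G vs" unfolding ball_eq by auto
  then show "g \<otimes> h \<in> ball (m + n)"
    unfolding ball_eq by (auto intro!: exI[of _ "us @ vs"] simp: word_prod_append)
qed

lemma carrier_eq_Union_ball: "g \<in> carrier G \<Longrightarrow> \<exists>n. g \<in> ball n"
  using gens_generate[of g] unfolding ball_eq by blast

lemma ball_Suc: "ball (Suc n) = ball n \<union> {t \<otimes> g | t g. t \<in> sym_gens G r s \<and> g \<in> ball n}"
proof
  have "{t \<otimes> g | t g. t \<in> sym_gens G r s \<and> g \<in> ball n} \<subseteq> {t \<otimes> g | t g. t \<in> ball 1 \<and> g \<in> ball n}"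
  proof -
    have "sym_gens G r s \<subseteq> ball 1"
    proof
      fix t assume "t \<in> sym_gens G r s"
      then show "t \<in> ball 1"
        unfolding ball_eq using sym_gens_closed by (auto intro!: exI[of _ "[t]"] simp: word_prod_def)
    qed
    then show ?thesis by blast
  qed
  then show "ball n \<union> {t \<otimes> g | t g. t \<in> sym_gens G r s \<and> g \<in> ball n} \<subseteq> ball (Suc n)"
    using ball_mult[of 1 n] ball_mono[of n "Suc n"] by auto
next
  show "ball (Suc n) \<subseteq> ball n \<union> {t \<otimes> g | t g. t \<in> sym_gens G r s \<and> g \<in> ball n}"
  proof
    fix g assume "g \<in> ball (Suc n)"
    then obtain ws where ws: "set ws \<subseteq> sym_gens G r s" "length ws \<le> Suc n" "g = word_prod G ws"
      unfolding ball_eq by auto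
    show "g \<in> ball n \<union> {t \<otimes> g | t g. t \<in> sym_gens G r s \<and> g \<in> ball n}"
    proof (cases ws)
      case Nil
      then show ?thesis using ws one_in_ball by (simp add: word_prod_def)
    next
      case (Cons t us)
      then have "g = t \<otimes> word_prod G us" "t \<in> sym_gens G r s" "word_prod G us \<in> ball n"
        using ws unfolding ball_eq by (auto simp: word_prod_def)
      then show ?thesis by blast
    qed
  qed
qed

lemma meas_equiv_refine_ball: "meas_equiv M R \<Longrightarrow> meas_equiv M (refine R (ball n))"
  by (intro meas_equiv_refine finite_ball ball_closed)

text \<open>
  Adjoining to \<open>R\<close> one translate by a generator of a relation coarser than \<open>R\<close> does not increase
  \<open>F\<close>. If this raises the entropy of \<open>R\<close> by \<open>d\<close>, then it raises that of each
  \<open>R \<inter> shift_rel (s i) R\<close> by at most \<open>2 * d\<close>, and by at most \<open>d\<close> for the \<open>i\<close> whose generator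
  (or its inverse) was used; altogether \<open>F\<close> changes by at most
  \<open>(1 - 2 * r) * d + (2 * r - 1) * d = 0\<close>.
\<close>

lemma F_splitting:
  assumes R: "meas_equiv M R" and C: "meas_equiv M C" and "R \<subseteq> C" and t: "t \<in> sym_gens G r s"
  shows "F (R \<inter> shift_rel t C) \<le> F R"
proof -
  define D where "D = shift_rel t C"
  define d where "d = equiv_entropy M (R \<inter> D) - equiv_entropy M R"
  have tc: "t \<in> carrier G" using t sym_gens_closed by auto
  have D: "meas_equiv M D" unfolding D_def by (intro meas_equiv_shift_rel tc C)
  obtain j where j: "j \<in> {1..r}" "t = s j \<or> t = inv s j" using t by (auto simp: sym_gens_def)
  have step: "equiv_entropy M (R \<inter> D \<inter> shift_rel (s i) (R \<inter> D))
      \<le> equiv_entropy M (R \<inter> shift_rel (s i) R) + (if i = j then d else 2 * d)" if i: "i \<in> {1..r}" for i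
  proof -
    define V where "V = R \<inter> shift_rel (s i) R"
    have si: "s i \<in> carrier G" using i by (rule gen_closed)
    note sR = meas_equiv_shift_rel[OF si R] and sD = meas_equiv_shift_rel[OF si D]
    have V: "meas_equiv M V" unfolding V_def by (intro meas_equiv_Int R sR)
    have VD: "meas_equiv M (V \<inter> D)" by (intro meas_equiv_Int V D)
    have 1: "equiv_entropy M (V \<inter> D) \<le> equiv_entropy M V + d"
      unfolding d_def by (intro equiv_entropy_Int_cond V D R) (simp add: V_def)
    have "equiv_entropy M (V \<inter> D \<inter> shift_rel (s i) D) \<le> equiv_entropy M (V \<inter> D)
        + (equiv_entropy M (shift_rel (s i) R \<inter> shift_rel (s i) D) - equiv_entropy M (shift_rel (s i) R))"
      by (intro equiv_entropy_Int_cond VD sD sR) (auto simp: V_def)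
    also have "\<dots> = equiv_entropy M (V \<inter> D) + d"
      by (simp add: d_def equiv_entropy_shift_rel[OF si] R D meas_equiv_Int flip: shift_rel_Int)
    finally have 2: "equiv_entropy M (V \<inter> D \<inter> shift_rel (s i) D) \<le> equiv_entropy M (V \<inter> D) + d" .
    have eq: "R \<inter> D \<inter> shift_rel (s i) (R \<inter> D) = V \<inter> D \<inter> shift_rel (s i) D"
      by (auto simp: V_def shift_rel_Int)
    show ?thesis
    proof (cases "i = j")
      case True
      have "V \<inter> D = V \<or> V \<inter> D \<inter> shift_rel (s i) D = V \<inter> D"
        using j(2)
      proof
        assume "t = s j"
        then have "shift_rel (s i) R \<subseteq> D"
          unfolding D_def using True \<open>R \<subseteq> C\<close> by (simp add: shift_rel_mono)
        then have "V \<inter> D = V" by (auto simp: V_def)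
        then show ?thesis ..
      next
        assume "t = inv s j"
        then have "shift_rel (s i) D = C"
          unfolding D_def using True si meas_equivD(4)[OF C]
          by (simp add: shift_rel_shift_rel shift_rel_one)
        then have "V \<inter> D \<inter> shift_rel (s i) D = V \<inter> D"
          using \<open>R \<subseteq> C\<close> by (auto simp: V_def)
        then show ?thesis ..
      qed
      then show ?thesis using 1 2 True unfolding eq V_def[symmetric] by auto
    next
      case False
      then show ?thesis using 1 2 unfolding eq V_def[symmetric] by auto
    qed
  qed
  have "(\<Sum>i=1..r. equiv_entropy M (R \<inter> D \<inter> shift_rel (s i) (R \<inter> D)))
      \<le> (\<Sum>i=1..r. equiv_entropy M (R \<inter> shift_rel (s i) R) + (if i = j then d else 2 * d))"
    by (intro sum_mono step)
  also have "\<dots> = (\<Sum>i=1..r. equiv_entropy M (R \<inter> shift_rel (s i) R)) + (2 * real r - 1) * d"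
  proof -
    have "(\<Sum>i=1..r. if i = j then d else 2 * d) = (\<Sum>i=1..r. 2 * d - (if i = j then d else 0))"
      by (intro sum.cong) auto
    also have "\<dots> = (2 * real r - 1) * d"
      using j(1) by (simp add: sum_subtractf algebra_simps)
    finally show ?thesis by (simp add: sum.distrib)
  qed
  finally show ?thesis unfolding F_def D_def[symmetric] by (simp add: d_def algebra_simps)
qed

lemma F_splitting_finite:
  assumes R: "meas_equiv M R" and C: "meas_equiv M C" and "R \<subseteq> C" and Q: "finite Q" "Q \<subseteq> sym_gens G r s"
  shows "F (R \<inter> refine C Q) \<le> F R"
  using Q
proof (induction Q rule: finite_induct)
  case empty
  have "R \<inter> refine C {} = R" using meas_equivD(4)[OF R] by (auto simp: refine_empty)
  then show ?case by simp
next
  case (insert t Q)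
  have "meas_equiv M (R \<inter> refine C Q)"
    using insert sym_gens_closed by (intro meas_equiv_Int R meas_equiv_refine C) auto
  then have "F (R \<inter> refine C Q \<inter> shift_rel t C) \<le> F (R \<inter> refine C Q)"
    using insert \<open>R \<subseteq> C\<close> by (intro F_splitting C) auto
  also have "\<dots> \<le> F R" using insert by simp
  finally show ?case by (simp add: refine_insert Int_ac)
qed

lemma F_splitting_ball:
  assumes R: "meas_equiv M R" and C: "meas_equiv M C" and "R \<subseteq> C"
  shows "F (R \<inter> refine C (ball n)) \<le> F R"
proof (induction n)
  case 0
  have "R \<inter> refine C (ball 0) = R"
    using \<open>R \<subseteq> C\<close> meas_equivD(4)[OF C] meas_equivD(4)[OF R]
    by (auto simp: ball_0 refine_insert refine_empty shift_rel_one)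
  then show ?case by simp
next
  case (Suc n)
  let ?C = "refine C (ball n)"
  have "R \<inter> refine C (ball (Suc n)) = R \<inter> ?C \<inter> refine ?C (sym_gens G r s)"
    by (auto simp: ball_Suc refine_Un refine_refine[OF ball_closed sym_gens_closed])
  moreover have "F (R \<inter> ?C \<inter> refine ?C (sym_gens G r s)) \<le> F (R \<inter> ?C)"
    by (intro F_splitting_finite meas_equiv_Int meas_equiv_refine_ball R C) (auto simp: sym_gens_def)
  ultimately show ?case using Suc by simp
qed

text \<open>
  If each of \<open>R\<close> and \<open>C\<close> is coarser than a ball refinement of the other, then some ball
  refinement of \<open>C\<close> is reached from \<open>R\<close> by splittings.
\<close>

lemma F_refine_le_of_equivalent:
  assumes R: "meas_equiv M R" and C: "meas_equiv M C"
    and "refine R (ball l) \<subseteq> C" and "refine C (ball m) \<subseteq> R"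
  shows "F (refine C (ball (l + m))) \<le> F R"
proof -
  \<comment> \<open>Split from \<open>R\<close> to \<open>?S\<close>, which refines \<open>C\<close>; then adjoin translates of \<open>C\<close> until they absorb \<open>?S\<close>.\<close>
  let ?S = "refine R (ball l)"
  have "refine C (ball (l + m)) \<subseteq> refine (refine C (ball m)) (ball l)"
    unfolding refine_refine[OF ball_closed ball_closed] by (intro refine_mono order_refl ball_mult)
  also have "\<dots> \<subseteq> ?S" using assms(4) by (intro refine_mono order_refl)
  finally have "refine C (ball (l + m)) = ?S \<inter> refine C (ball (l + m))" by auto
  also have "F \<dots> \<le> F ?S"
    using assms(3) by (intro F_splitting_ball meas_equiv_refine_ball R C)
  also have "?S = R \<inter> ?S"
    using refine_subset[OF meas_equivD(4)[OF R] one_in_ball] by auto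
  also have "F \<dots> \<le> F R" by (intro F_splitting_ball R order_refl)
  finally show ?thesis .
qed

end

section \<open>Relations of small entropy\<close>

text \<open>
  The classes of \<open>localize M E R\<close> are the complement of \<open>E\<close> and the traces on \<open>E\<close> of the classes of
  \<open>R\<close>. Its intersection with a relation that agrees with \<open>R\<close> outside \<open>E\<close> is contained in \<open>R\<close>.
\<close>

definition localize :: "'x measure \<Rightarrow> 'x set \<Rightarrow> ('x \<times> 'x) set \<Rightarrow> ('x \<times> 'x) set" where
  "localize M E R = {(x, y) \<in> space M \<times> space M. x \<notin> E \<and> y \<notin> E \<or> x \<in> E \<and> y \<in> E \<and> (x, y) \<in> R}"

lemma ex_neg_x_ln_x_small:
  assumes "0 < (\<epsilon>::real)"
  shows "\<exists>e>0. \<forall>x. 0 \<le> x \<and> x \<le> e \<or> 1 - e \<le> x \<and> x \<le> 1 \<longrightarrow> - (x * ln x) \<le> \<epsilon>"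
proof -
  have "((\<lambda>x::real. - (x * ln x)) \<longlongrightarrow> 0) (at_right 0)" by real_asymp
  then have "\<forall>\<^sub>F x::real in at_right 0. - (x * ln x) < \<epsilon>"
    using assms by (rule order_tendstoD(2))
  then obtain a where a: "0 < a" "\<And>x. 0 < x \<Longrightarrow> x < a \<Longrightarrow> - (x * ln x) < \<epsilon>"
    unfolding eventually_at_right_field by auto
  have "((\<lambda>x::real. - (x * ln x)) \<longlongrightarrow> - (1 * ln 1)) (at_left 1)"
    by (intro tendsto_intros) auto
  then have "\<forall>\<^sub>F x::real in at_left 1. - (x * ln x) < \<epsilon>"
    using assms by (intro order_tendstoD(2)) auto
  then obtain b where b: "b < 1" "\<And>x. b < x \<Longrightarrow> x < 1 \<Longrightarrow> - (x * ln x) < \<epsilon>"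
    unfolding eventually_at_left_field by auto
  define e where "e = min (a / 2) ((1 - b) / 2)"
  have e: "0 < e" "e < a" "b < 1 - e" using a(1) b(1) by (auto simp: e_def field_simps min_def)
  have "- (x * ln x) \<le> \<epsilon>" if "0 \<le> x \<and> x \<le> e \<or> 1 - e \<le> x \<and> x \<le> 1" for x
  proof (cases "x = 0 \<or> x = 1")
    case True
    then show ?thesis using assms by auto
  next
    case False
    then show ?thesis using that a(2)[of x] b(2)[of x] e by fastforce
  qed
  then show ?thesis using e(1) by blast
qed

context prob_space
begin

lemma equiv_localize:
  assumes "equiv (space M) R"
  shows "equiv (space M) (localize M E R)"
proof (rule equivI)
  show "localize M E R \<subseteq> space M \<times> space M" by (auto simp: localize_def)
  have "refl_on (space M) R" "sym R" "trans R" using assms by (auto elim: equivE)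
  then show "refl_on (space M) (localize M E R)" "sym (localize M E R)"
    by (auto simp: localize_def refl_on_def sym_def)
  show "trans (localize M E R)"
  proof (rule transI)
    fix x y z assume "(x, y) \<in> localize M E R" "(y, z) \<in> localize M E R"
    then show "(x, z) \<in> localize M E R"
      using transD[OF \<open>trans R\<close>, of x y z] unfolding localize_def by auto
  qed
qed

lemma quotient_localize:
  assumes "equiv (space M) R"
  shows "space M // localize M E R \<subseteq> insert (space M - E) ((\<lambda>C. C \<inter> E) ` (space M // R))"
proof
  fix D assume "D \<in> space M // localize M E R"
  then obtain x where x: "x \<in> space M" "D = localize M E R `` {x}" by (rule quotientE)
  show "D \<in> insert (space M - E) ((\<lambda>C. C \<inter> E) ` (space M // R))"
  proof (cases "x \<in> E")
    case True
    then have "D = R `` {x} \<inter> E" using x equiv_type[OF assms] by (auto simp: localize_def)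
    moreover have "R `` {x} \<in> space M // R" using x(1) by (rule quotientI)
    ultimately show ?thesis by blast
  next
    case False
    then have "D = space M - E" using x by (auto simp: localize_def)
    then show ?thesis by simp
  qed
qed

lemma meas_equiv_localize:
  assumes "meas_equiv M R" "E \<in> sets M"
  shows "meas_equiv M (localize M E R)"
proof -
  note R = meas_equivD[OF assms(1)]
  note q = quotient_localize[OF R(1), of E]
  have "finite (space M // localize M E R)" by (rule finite_subset[OF q]) (simp add: R(2))
  moreover have "space M // localize M E R \<subseteq> sets M" by (rule order_trans[OF q]) (use assms(2) R(3) in auto)
  ultimately show ?thesis by (simp add: meas_equiv_def equiv_localize R(1))
qed

text \<open>
  The bound on the measure of \<open>E\<close> depends on the number of classes of \<open>R\<close> only: each of the at most
  \<open>k + 1\<close> classes of the localization has measure near 0 or near 1, where \<open>- x * ln x\<close> is small.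
\<close>

lemma ex_localize_entropy_small:
  assumes "0 < \<epsilon>"
  shows "\<exists>e>0. \<forall>R E. meas_equiv M R \<longrightarrow> card (space M // R) \<le> k \<longrightarrow> E \<in> sets M \<longrightarrow> prob E \<le> e \<longrightarrow>
    equiv_entropy M (localize M E R) \<le> \<epsilon>"
proof -
  have "0 < \<epsilon> / real (k + 1)" using assms by simp
  from ex_neg_x_ln_x_small[OF this] obtain e where e: "0 < e"
    "\<And>x. 0 \<le> x \<and> x \<le> e \<or> 1 - e \<le> x \<and> x \<le> 1 \<Longrightarrow> - (x * ln x) \<le> \<epsilon> / real (k + 1)" by blast
  have "equiv_entropy M (localize M E R) \<le> \<epsilon>"
    if R: "meas_equiv M R" and k: "card (space M // R) \<le> k" and E: "E \<in> sets M" "prob E \<le> e" for R E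
  proof -
    note R' = meas_equivD[OF R]
    let ?Q = "space M // localize M E R"
    note q = quotient_localize[OF R'(1), of E]
    have fin: "finite (insert (space M - E) ((\<lambda>C. C \<inter> E) ` (space M // R)))" using R'(2) by simp
    have "card ?Q \<le> card (insert (space M - E) ((\<lambda>C. C \<inter> E) ` (space M // R)))"
      using card_mono[OF fin q] .
    also have "\<dots> \<le> k + 1"
      using card_image_le[OF R'(2), of "\<lambda>C. C \<inter> E"] k by (simp add: card_insert_if R'(2))
    finally have card: "card ?Q \<le> k + 1" .
    have "- (prob D * ln (prob D)) \<le> \<epsilon> / real (k + 1)" if "D \<in> ?Q" for D
    proof (rule e(2))
      have "D = space M - E \<or> D \<subseteq> E" using q that by auto
      then show "0 \<le> prob D \<and> prob D \<le> e \<or> 1 - e \<le> prob D \<and> prob D \<le> 1"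
      proof
        assume "D = space M - E"
        then show ?thesis using E prob_compl[OF E(1)] by simp
      next
        assume "D \<subseteq> E"
        then show ?thesis using E finite_measure_mono[of D E] by auto
      qed
    qed
    then have "equiv_entropy M (localize M E R) \<le> (\<Sum>D\<in>?Q. \<epsilon> / real (k + 1))"
      unfolding equiv_entropy_def partition_entropy_def sum_negf[symmetric] by (intro sum_mono)
    also have "\<dots> = real (card ?Q) * (\<epsilon> / real (k + 1))" by simp
    also have "\<dots> \<le> real (k + 1) * (\<epsilon> / real (k + 1))"
      using card assms by (intro mult_right_mono) auto
    also have "\<dots> = \<epsilon>" by (simp add: field_simps)
    finally show ?thesis .
  qed
  then show ?thesis using e(1) by blast
qed

end

section \<open>Approximation by refinements of a generating relation\<close>

context prob_space
begin

text \<open>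
  \<open>A\<close> is a union of classes of \<open>Q\<close>.
\<close>

definition saturated :: "('a \<times> 'a) set \<Rightarrow> 'a set \<Rightarrow> bool" where
  "saturated Q A \<longleftrightarrow> A \<subseteq> space M \<and> Q `` A \<subseteq> A"

lemma saturated_iff:
  assumes "saturated Q A" "(x, y) \<in> Q" "(y, x) \<in> Q"
  shows "x \<in> A \<longleftrightarrow> y \<in> A"
  using assms unfolding saturated_def by blast

lemma saturated_mono: "saturated Q A \<Longrightarrow> Q' \<subseteq> Q \<Longrightarrow> saturated Q' A"
  unfolding saturated_def by blast

lemma saturated_Un: "saturated Q A \<Longrightarrow> saturated Q B \<Longrightarrow> saturated Q (A \<union> B)"
  unfolding saturated_def by blast

lemma saturated_class:
  assumes "equiv (space M) Q" "C \<in> space M // Q"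
  shows "saturated Q C"
  using assms equiv_class_unique[OF assms] unfolding saturated_def by blast

lemma saturated_sets:
  assumes "meas_equiv M Q" "saturated Q A"
  shows "A \<in> sets M"
proof -
  note Q = meas_equivD[OF assms(1)]
  have "A = \<Union>{C \<in> space M // Q. C \<subseteq> A}"
  proof
    show "A \<subseteq> \<Union>{C \<in> space M // Q. C \<subseteq> A}"
    proof
      fix x assume x: "x \<in> A"
      then have "x \<in> space M" "Q `` {x} \<subseteq> A" using assms(2) by (auto simp: saturated_def)
      then show "x \<in> \<Union>{C \<in> space M // Q. C \<subseteq> A}"
        using Q(5)[of x] by (intro UnionI[of "Q `` {x}"]) (auto simp: quotientI)
    qed
  qed auto
  also have "\<dots> \<in> sets M" using Q(2,3) by (intro sets.finite_Union) auto
  finally show ?thesis .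
qed

lemma saturated_compl:
  assumes "meas_equiv M Q" "saturated Q A"
  shows "saturated Q (space M - A)"
  using assms(2) meas_equivD(4,6)[OF assms(1)] unfolding saturated_def by blast

end

context finitely_generated_action
begin

text \<open>
  The measurable set \<open>A\<close> can be approximated in measure by unions of classes of ball refinements
  of \<open>R\<close>. For a finite measurable \<open>R\<close> these sets form an invariant \<open>\<sigma>\<close>-algebra.
\<close>

definition approximable :: "('x \<times> 'x) set \<Rightarrow> 'x set \<Rightarrow> bool" where
  "approximable R A \<longleftrightarrow> A \<in> sets M \<and>
     (\<forall>\<epsilon>>0. \<exists>n B. saturated (refine R (ball n)) B \<and> prob ((A - B) \<union> (B - A)) < \<epsilon>)"

lemma saturated_refine_sets:
  "meas_equiv M R \<Longrightarrow> saturated (refine R (ball n)) B \<Longrightarrow> B \<in> sets M"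
  using saturated_sets meas_equiv_refine_ball by blast

lemma saturated_refine_mono:
  "saturated (refine R (ball n)) B \<Longrightarrow> n \<le> m \<Longrightarrow> saturated (refine R (ball m)) B"
  by (erule saturated_mono) (intro refine_mono ball_mono order_refl)

lemma approximable_saturated:
  assumes "meas_equiv M R" "saturated R A"
  shows "approximable R A"
proof -
  have "saturated (refine R (ball 0)) A"
    using assms(2) by (rule saturated_mono) (intro refine_subset meas_equivD(4)[OF assms(1)] one_in_ball)
  moreover have "prob ((A - A) \<union> (A - A)) < \<epsilon>" if "0 < \<epsilon>" for \<epsilon> using that by simp
  ultimately show ?thesis using saturated_sets[OF assms] unfolding approximable_def by blast
qed

lemma approximable_limit:
  assumes R: "meas_equiv M R" and A: "A \<in> sets M"
    and lim: "\<And>\<epsilon>. 0 < \<epsilon> \<Longrightarrow> \<exists>B. approximable R B \<and> prob ((A - B) \<union> (B - A)) < \<epsilon>"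
  shows "approximable R A"
  unfolding approximable_def
proof (intro conjI A allI impI)
  fix \<epsilon> :: real assume "0 < \<epsilon>"
  then obtain B where B: "approximable R B" "prob ((A - B) \<union> (B - A)) < \<epsilon> / 2"
    using lim[of "\<epsilon> / 2"] by auto
  then obtain n C where C: "saturated (refine R (ball n)) C" "prob ((B - C) \<union> (C - B)) < \<epsilon> / 2"
    using \<open>0 < \<epsilon>\<close> unfolding approximable_def by (meson half_gt_zero)
  have BM: "B \<in> sets M" using B(1) by (simp add: approximable_def)
  have CM: "C \<in> sets M" using saturated_refine_sets[OF R C(1)] .
  have "prob ((A - C) \<union> (C - A)) \<le> prob (((A - B) \<union> (B - A)) \<union> ((B - C) \<union> (C - B)))"
    using A BM CM by (intro finite_measure_mono) auto
  also have "\<dots> \<le> prob ((A - B) \<union> (B - A)) + prob ((B - C) \<union> (C - B))"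
    using A BM CM by (intro measure_Un_le) auto
  also have "\<dots> < \<epsilon>" using B(2) C(2) by linarith
  finally show "\<exists>n B. saturated (refine R (ball n)) B \<and> prob ((A - B) \<union> (B - A)) < \<epsilon>"
    using C(1) by blast
qed

lemma approximable_compl:
  assumes R: "meas_equiv M R" and A: "approximable R A"
  shows "approximable R (space M - A)"
  unfolding approximable_def
proof (intro conjI allI impI)
  show "space M - A \<in> sets M" using A by (auto simp: approximable_def)
  fix \<epsilon> :: real assume "0 < \<epsilon>"
  then obtain n B where B: "saturated (refine R (ball n)) B" "prob ((A - B) \<union> (B - A)) < \<epsilon>"
    using A unfolding approximable_def by blast
  have "A \<subseteq> space M" "B \<subseteq> space M"
    using A B(1) sets.sets_into_space by (auto simp: approximable_def saturated_def)
  then have "((space M - A) - (space M - B)) \<union> ((space M - B) - (space M - A)) = (A - B) \<union> (B - A)"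
    by auto
  then show "\<exists>n B. saturated (refine R (ball n)) B \<and> prob ((space M - A - B) \<union> (B - (space M - A))) < \<epsilon>"
    using saturated_compl[OF meas_equiv_refine_ball[OF R] B(1)] B(2) by metis
qed

lemma approximable_Un:
  assumes R: "meas_equiv M R" and "approximable R A1" "approximable R A2"
  shows "approximable R (A1 \<union> A2)"
  unfolding approximable_def
proof (intro conjI allI impI)
  have AM: "A1 \<in> sets M" "A2 \<in> sets M" using assms by (auto simp: approximable_def)
  then show "A1 \<union> A2 \<in> sets M" by auto
  fix \<epsilon> :: real assume "0 < \<epsilon>"
  then have e: "0 < \<epsilon> / 2" by simp
  obtain n1 B1 where B1: "saturated (refine R (ball n1)) B1" "prob ((A1 - B1) \<union> (B1 - A1)) < \<epsilon> / 2"
    using assms(2) e unfolding approximable_def by blast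
  obtain n2 B2 where B2: "saturated (refine R (ball n2)) B2" "prob ((A2 - B2) \<union> (B2 - A2)) < \<epsilon> / 2"
    using assms(3) e unfolding approximable_def by blast
  have sat: "saturated (refine R (ball (max n1 n2))) (B1 \<union> B2)"
    using B1(1) B2(1) by (intro saturated_Un) (auto intro: saturated_refine_mono)
  have BM: "B1 \<in> sets M" "B2 \<in> sets M" using saturated_refine_sets[OF R] B1(1) B2(1) by auto
  have "prob ((A1 \<union> A2 - (B1 \<union> B2)) \<union> (B1 \<union> B2 - (A1 \<union> A2)))
      \<le> prob (((A1 - B1) \<union> (B1 - A1)) \<union> ((A2 - B2) \<union> (B2 - A2)))"
    using AM BM by (intro finite_measure_mono) auto
  also have "\<dots> \<le> prob ((A1 - B1) \<union> (B1 - A1)) + prob ((A2 - B2) \<union> (B2 - A2))"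
    using AM BM by (intro measure_Un_le) auto
  also have "\<dots> < \<epsilon>" using B1(2) B2(2) by linarith
  finally show "\<exists>n B. saturated (refine R (ball n)) B \<and> prob ((A1 \<union> A2 - B) \<union> (B - (A1 \<union> A2))) < \<epsilon>"
    using sat by blast
qed

lemma approximable_empty: "meas_equiv M R \<Longrightarrow> approximable R {}"
  by (intro approximable_saturated) (auto simp: saturated_def)

lemma approximable_UN:
  fixes A :: "nat \<Rightarrow> 'x set"
  assumes R: "meas_equiv M R" and A: "\<And>i. approximable R (A i)"
  shows "approximable R (\<Union>i. A i)"
proof (rule approximable_limit[OF R])
  have AM: "A i \<in> sets M" for i using A by (simp add: approximable_def)
  then show UM: "(\<Union>i. A i) \<in> sets M" by auto
  have fin: "approximable R (\<Union>i<n. A i)" for n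
    by (induction n) (auto simp: lessThan_Suc approximable_empty[OF R] intro!: approximable_Un[OF R] A)
  fix \<epsilon> :: real assume "0 < \<epsilon>"
  have "(\<lambda>n. prob (\<Union>i<n. A i)) \<longlonglongrightarrow> prob (\<Union>n. \<Union>i<n. A i)"
    using AM by (intro finite_Lim_measure_incseq) (auto simp: incseq_def intro: less_le_trans)
  moreover have "(\<Union>n. \<Union>i<n. A i) = (\<Union>i. A i)" by auto
  ultimately have "\<forall>\<^sub>F n in sequentially. prob (\<Union>i. A i) - \<epsilon> < prob (\<Union>i<n. A i)"
    using \<open>0 < \<epsilon>\<close> by (intro order_tendstoD(1)) auto
  then obtain n where n: "prob (\<Union>i. A i) - \<epsilon> < prob (\<Union>i<n. A i)"
    using eventually_happens by fastforce
  have "prob (((\<Union>i. A i) - (\<Union>i<n. A i)) \<union> ((\<Union>i<n. A i) - (\<Union>i. A i))) = prob ((\<Union>i. A i) - (\<Union>i<n. A i))"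
    by (intro arg_cong[where f = prob]) auto
  also have "\<dots> = prob (\<Union>i. A i) - prob (\<Union>i<n. A i)"
    using AM UM by (intro finite_measure_Diff) auto
  finally show "\<exists>B. approximable R B \<and> prob (((\<Union>i. A i) - B) \<union> (B - (\<Union>i. A i))) < \<epsilon>"
    using fin n by (intro exI[of _ "\<Union>i<n. A i"]) auto
qed

lemma saturated_T_image:
  assumes g: "g \<in> ball m" and B: "saturated (refine R (ball n)) B"
  shows "saturated (refine R (ball (m + n))) (T g ` B)"
proof -
  have gc: "g \<in> carrier G" using g ball_closed by auto
  have BX: "B \<subseteq> space M" using B by (simp add: saturated_def)
  have sub: "refine R (ball (m + n)) \<subseteq> shift_rel g (refine R (ball n))"
  proof -
    have "{g \<otimes> h | h. h \<in> ball n} \<subseteq> ball (m + n)" using ball_mult[of m n] g by blast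
    moreover have "shift_rel g (refine R (ball n)) = refine R {g \<otimes> h | h. h \<in> ball n}"
      using refine_refine[of "ball n" "{g}" R] gc ball_closed
      by (auto simp: refine_insert refine_empty shift_rel_def)
    ultimately show ?thesis by (simp add: refine_mono)
  qed
  have "saturated (shift_rel g (refine R (ball n))) (T g ` B)"
    using B BX gc unfolding saturated_def T_image_eq[OF gc BX] by (auto simp: shift_rel_def)
  then show ?thesis using sub by (rule saturated_mono)
qed

lemma approximable_T_image:
  assumes R: "meas_equiv M R" and A: "approximable R A" and g: "g \<in> carrier G"
  shows "approximable R (T g ` A)"
  unfolding approximable_def
proof (intro conjI allI impI)
  have AM: "A \<in> sets M" using A by (simp add: approximable_def)
  then show "T g ` A \<in> sets M" by (intro T_image_sets(1) g)
  fix \<epsilon> :: real assume "0 < \<epsilon>"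
  then obtain n B where B: "saturated (refine R (ball n)) B" "prob ((A - B) \<union> (B - A)) < \<epsilon>"
    using A unfolding approximable_def by blast
  obtain m where m: "g \<in> ball m" using carrier_eq_Union_ball[OF g] by blast
  have BM: "B \<in> sets M" using saturated_refine_sets[OF R B(1)] .
  have inj: "inj_on (T g) (space M)" using g by (intro inj_on_inverseI[of _ "T (inv g)"]) (simp add: T_inv)
  have "(T g ` A - T g ` B) \<union> (T g ` B - T g ` A) = T g ` ((A - B) \<union> (B - A))"
    using inj_on_image_set_diff[OF inj, of A B] inj_on_image_set_diff[OF inj, of B A]
      sets.sets_into_space[OF AM] sets.sets_into_space[OF BM] by (simp add: image_Un) blast
  then have "prob ((T g ` A - T g ` B) \<union> (T g ` B - T g ` A)) < \<epsilon>"
    using B(2) AM BM by (simp add: T_image_sets(2)[OF g])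
  then show "\<exists>n B. saturated (refine R (ball n)) B \<and> prob ((T g ` A - B) \<union> (B - T g ` A)) < \<epsilon>"
    using saturated_T_image[OF m B(1)] by blast
qed

lemma invariant_sigma_approximable:
  assumes R: "meas_equiv M R" and "\<And>A. A \<in> \<alpha> \<Longrightarrow> saturated R A" and A: "A \<in> invariant_sigma G M T \<alpha>"
  shows "approximable R A"
proof -
  have "sigma_algebra (space M) (Collect (approximable R))"
    unfolding sigma_algebra_iff2
  proof (intro conjI ballI allI impI)
    show "Collect (approximable R) \<subseteq> Pow (space M)"
      unfolding approximable_def using sets.sets_into_space by blast
  qed (use approximable_empty[OF R] approximable_compl[OF R] in auto, use approximable_UN[OF R] in blast)
  moreover have "\<alpha> \<subseteq> Collect (approximable R)" using assms by (auto intro: approximable_saturated)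
  moreover have "\<forall>g\<in>carrier G. \<forall>A\<in>Collect (approximable R). T g ` A \<in> Collect (approximable R)"
    using approximable_T_image[OF R] by auto
  ultimately have "A \<in> Collect (approximable R)" using A unfolding invariant_sigma_def by blast
  then show ?thesis by simp
qed

text \<open>
  \<open>R\<close> is generating, expressed by approximation: every measurable set is approximable.
\<close>

definition generates :: "('x \<times> 'x) set \<Rightarrow> bool" where
  "generates R \<longleftrightarrow> meas_equiv M R \<and> (\<forall>A\<in>sets M. approximable R A)"

lemma ex_approximating_family:
  assumes R: "generates R" and Q: "finite \<A>" "\<A> \<subseteq> sets M" and "0 < \<epsilon>"
  shows "\<exists>n B. (\<forall>A\<in>\<A>. saturated (refine R (ball n)) (B A)) \<and> prob (\<Union>A\<in>\<A>. (A - B A) \<union> (B A - A)) < \<epsilon>"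
proof -
  have Rm: "meas_equiv M R" using R by (simp add: generates_def)
  define \<delta> where "\<delta> = \<epsilon> / (real (card \<A>) + 1)"
  have \<delta>: "0 < \<delta>" using \<open>0 < \<epsilon>\<close> by (simp add: \<delta>_def add_nonneg_pos)
  have "\<forall>A\<in>\<A>. \<exists>n B. saturated (refine R (ball n)) B \<and> prob ((A - B) \<union> (B - A)) < \<delta>"
    using R Q(2) \<delta> unfolding generates_def approximable_def by blast
  then obtain n B where nB: "\<And>A. A \<in> \<A> \<Longrightarrow> saturated (refine R (ball (n A))) (B A)"
    "\<And>A. A \<in> \<A> \<Longrightarrow> prob ((A - B A) \<union> (B A - A)) < \<delta>" by metis
  define N where "N = (\<Sum>A\<in>\<A>. n A)"
  have sat: "saturated (refine R (ball N)) (B A)" if "A \<in> \<A>" for A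
    using nB(1)[OF that] by (rule saturated_refine_mono) (simp add: N_def Q that member_le_sum)
  have BM: "B A \<in> sets M" if "A \<in> \<A>" for A using saturated_refine_sets[OF Rm sat[OF that]] .
  have "prob (\<Union>A\<in>\<A>. (A - B A) \<union> (B A - A)) \<le> (\<Sum>A\<in>\<A>. prob ((A - B A) \<union> (B A - A)))"
    using Q BM by (intro finite_measure_subadditive_finite) auto
  also have "\<dots> \<le> (\<Sum>A\<in>\<A>. \<delta>)" by (intro sum_mono less_imp_le nB(2))
  also have "\<dots> = real (card \<A>) * \<delta>" by simp
  also have "\<dots> < \<epsilon>" using \<open>0 < \<epsilon>\<close> by (simp add: \<delta>_def field_simps)
  finally show ?thesis using sat by blast
qed

end

section \<open>Independence of the generating partition\<close>

context finitely_generated_action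
begin

lemma equiv_entropy_UNIV: "equiv_entropy M (space M \<times> space M) = 0"
proof -
  have "space M // (space M \<times> space M) = {space M}"
    using not_empty unfolding quotient_def by auto
  then show ?thesis by (simp add: equiv_entropy_def partition_entropy_def prob_space)
qed

lemma equiv_entropy_Int_le:
  assumes "meas_equiv M R" "meas_equiv M S"
  shows "equiv_entropy M (R \<inter> S) \<le> equiv_entropy M R + equiv_entropy M S"
proof -
  have "space M \<times> space M \<inter> S = S" using meas_equivD(4)[OF assms(2)] by auto
  then show ?thesis
    using equiv_entropy_Int_cond[OF assms meas_equiv_UNIV meas_equivD(4)[OF assms(1)]]
    by (simp add: equiv_entropy_UNIV)
qed

text \<open>
  \<open>F\<close> changes little between \<open>R\<close> and \<open>S\<close> if each becomes finer than the other after adjoining a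
  relation of small entropy.
\<close>

lemma F_perturbation:
  assumes R: "meas_equiv M R" and S: "meas_equiv M S" and Z: "meas_equiv M Z" and Y: "meas_equiv M Y"
    and "R \<inter> Z \<subseteq> S" and "S \<inter> Y \<subseteq> R"
  shows "F S \<le> F R + 2 * real r * equiv_entropy M Y + (2 * real r + 1) * equiv_entropy M Z"
proof -
  let ?H = "equiv_entropy M"
  have 1: "?H S \<le> ?H R + ?H Z"
    using equiv_entropy_mono[OF meas_equiv_Int[OF R Z] S assms(5)] equiv_entropy_Int_le[OF R Z] by linarith
  have 2: "?H R \<le> ?H S + ?H Y"
    using equiv_entropy_mono[OF meas_equiv_Int[OF S Y] R assms(6)] equiv_entropy_Int_le[OF S Y] by linarith
  have 3: "?H (S \<inter> shift_rel (s i) S) \<le> ?H (R \<inter> shift_rel (s i) R) + 2 * ?H Z" if i: "i \<in> {1..r}" for i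
  proof -
    note si = gen_closed[OF i]
    let ?R = "R \<inter> shift_rel (s i) R" and ?Z = "Z \<inter> shift_rel (s i) Z"
    have m: "meas_equiv M ?R" "meas_equiv M ?Z" "meas_equiv M (S \<inter> shift_rel (s i) S)"
      by (intro meas_equiv_Int meas_equiv_shift_rel si R Z S)+
    have "?R \<inter> ?Z \<subseteq> S \<inter> shift_rel (s i) S"
      using assms(5) shift_rel_mono[OF assms(5), of "s i"] by (auto simp: shift_rel_Int)
    then have "?H (S \<inter> shift_rel (s i) S) \<le> ?H (?R \<inter> ?Z)"
      by (intro equiv_entropy_mono meas_equiv_Int m) 
    also have "\<dots> \<le> ?H ?R + ?H ?Z" by (intro equiv_entropy_Int_le m)
    also have "?H ?Z \<le> ?H Z + ?H (shift_rel (s i) Z)"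
      by (intro equiv_entropy_Int_le meas_equiv_shift_rel si Z)
    finally show ?thesis by (simp add: equiv_entropy_shift_rel[OF si Z])
  qed
  have "(\<Sum>i=1..r. ?H (S \<inter> shift_rel (s i) S)) \<le> (\<Sum>i=1..r. ?H (R \<inter> shift_rel (s i) R) + 2 * ?H Z)"
    by (intro sum_mono 3)
  then have 4: "(\<Sum>i=1..r. ?H (S \<inter> shift_rel (s i) S))
      \<le> (\<Sum>i=1..r. ?H (R \<inter> shift_rel (s i) R)) + real r * (2 * ?H Z)"
    by (simp add: sum.distrib)
  have "real r * ?H R \<le> real r * (?H S + ?H Y)" using 2 by (intro mult_left_mono) auto
  then show ?thesis using 1 4 unfolding F_def by (simp add: algebra_simps)
qed

text \<open>
  If \<open>R\<close> and \<open>C\<close> are generating, then \<open>R\<close> can be perturbed, at a cost of at most \<open>\<epsilon>\<close> in \<open>F\<close>, to a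
  relation \<open>S\<close> such that \<open>S\<close> and \<open>C\<close> are each coarser than a ball refinement of the other. Since \<open>R\<close>
  is generating, some \<open>refine R (ball l)\<close> determines the classes of \<open>C\<close> outside a small set. With
  \<open>l\<close> fixed, replace \<open>R\<close> by a relation \<open>S1\<close> that is coarser than a ball refinement of \<open>C\<close> and
  agrees with \<open>R\<close> outside a set \<open>E1\<close> so small that its translates by \<open>ball l\<close> are still small in
  total. Then \<open>refine S1 (ball l)\<close> determines the classes of \<open>C\<close> outside a small set \<open>E3\<close>, and
  \<open>S\<close> is \<open>S1\<close> together with the localization of \<open>C\<close> to \<open>E3\<close>.
\<close>

lemma ex_equivalent_perturbation:
  assumes R: "generates R" and C: "generates C" and "0 < \<epsilon>"
  shows "\<exists>S l m. meas_equiv M S \<and> refine S (ball l) \<subseteq> C \<and> refine C (ball m) \<subseteq> S \<and> F S \<le> F R + \<epsilon>"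
proof -
  have Rm: "meas_equiv M R" and Cm: "meas_equiv M C" using R C by (auto simp: generates_def)
  note R' = meas_equivD[OF Rm] and C' = meas_equivD[OF Cm]
  define k where "k = max (2 ^ card (space M // R)) (card (space M // C))"
  have k: "2 ^ card (space M // R) \<le> k" "card (space M // C) \<le> k" "card (space M // R) \<le> k"
    using less_imp_le[OF less_exp[of "card (space M // R)"]] by (simp_all add: k_def le_max_iff_disj)
  \<comment> \<open>\<open>F_perturbation\<close> is used with \<open>Y\<close> of entropy at most \<open>\<epsilon>'\<close> and \<open>Z\<close> of entropy at most \<open>2 * \<epsilon>'\<close>.\<close>
  define \<epsilon>' where "\<epsilon>' = \<epsilon> / (6 * real r + 2)"
  have "0 < \<epsilon>'" using \<open>0 < \<epsilon>\<close> by (simp add: \<epsilon>'_def add_nonneg_pos)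
  obtain e where e: "0 < e" and small: "\<And>R E. meas_equiv M R \<Longrightarrow> card (space M // R) \<le> k \<Longrightarrow>
      E \<in> sets M \<Longrightarrow> prob E \<le> e \<Longrightarrow> equiv_entropy M (localize M E R) \<le> \<epsilon>'"
    using ex_localize_entropy_small[OF \<open>0 < \<epsilon>'\<close>, of k] by blast

  obtain l A' where A': "\<And>A. A \<in> space M // C \<Longrightarrow> saturated (refine R (ball l)) (A' A)"
    and "prob (\<Union>A\<in>space M // C. (A - A' A) \<union> (A' A - A)) < e / 2"
    using ex_approximating_family[OF R C'(2) subsetI[OF C'(3)] half_gt_zero[OF e]] by blast
  define E2 where "E2 = (\<Union>A\<in>space M // C. (A - A' A) \<union> (A' A - A))"
  have E2: "prob E2 < e / 2" unfolding E2_def by fact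
  have E2M: "E2 \<in> sets M"
    unfolding E2_def using C'(2,3) saturated_refine_sets[OF Rm A'] by (intro sets.finite_UN) auto

  define N where "N = real (card (ball l))"
  define e1 where "e1 = e / (2 * (N + 1))"
  have e1: "0 < e1" "e1 \<le> e" "N * e1 \<le> e / 2"
    using e by (auto simp: e1_def N_def field_simps)
  obtain m B' where B': "\<And>B. B \<in> space M // R \<Longrightarrow> saturated (refine C (ball m)) (B' B)"
    and "prob (\<Union>B\<in>space M // R. (B - B' B) \<union> (B' B - B)) < e1"
    using ex_approximating_family[OF C R'(2) subsetI[OF R'(3)] e1(1)] by blast
  define E1 where "E1 = (\<Union>B\<in>space M // R. (B - B' B) \<union> (B' B - B))"
  have E1: "prob E1 < e1" unfolding E1_def by fact
  have E1M: "E1 \<in> sets M"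
    unfolding E1_def using R'(2,3) saturated_refine_sets[OF Cm B'] by (intro sets.finite_UN) auto

  \<comment> \<open>\<open>S1\<close> has at most \<open>2 ^ card (space M // R)\<close> classes, a bound independent of \<open>m\<close>.\<close>
  define S1 where "S1 = {(x, y) \<in> space M \<times> space M. \<forall>B\<in>space M // R. x \<in> B' B \<longleftrightarrow> y \<in> B' B}"
  note mC = meas_equivD[OF meas_equiv_refine_ball[OF Cm]]
  have C_S1: "refine C (ball m) \<subseteq> S1"
  proof (rule subrelI)
    fix x y assume xy: "(x, y) \<in> refine C (ball m)"
    then have "x \<in> B' B \<longleftrightarrow> y \<in> B' B" if "B \<in> space M // R" for B
      using saturated_iff[OF B'[OF that]] mC(6) by blast
    then show "(x, y) \<in> S1" using xy mC(4) by (auto simp: S1_def)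
  qed
  have "equiv (space M) S1"
    by (intro equivI) (auto simp: S1_def refl_on_def sym_def trans_def)
  then have S1: "meas_equiv M S1"
    using meas_equiv_coarser[OF meas_equiv_refine_ball[OF Cm] _ C_S1] by simp
  have card_S1: "card (space M // S1) \<le> k"
  proof -
    let ?f = "\<lambda>\<B>. {y \<in> space M. {B \<in> space M // R. y \<in> B' B} = \<B>}"
    have "space M // S1 \<subseteq> ?f ` Pow (space M // R)"
    proof
      fix D assume "D \<in> space M // S1"
      then obtain x where "x \<in> space M" "D = S1 `` {x}" by (rule quotientE)
      then have "D = ?f {B \<in> space M // R. x \<in> B' B}" by (auto simp: S1_def)
      then show "D \<in> ?f ` Pow (space M // R)" by blast
    qed
    then have "card (space M // S1) \<le> card (?f ` Pow (space M // R))"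
      using R'(2) by (intro card_mono) auto
    also have "\<dots> \<le> card (Pow (space M // R))" using R'(2) by (intro card_image_le) simp
    also have "\<dots> = 2 ^ card (space M // R)" using R'(2) by (rule card_Pow)
    finally show ?thesis using k by simp
  qed
  have agree: "(x, y) \<in> S1 \<longleftrightarrow> (x, y) \<in> R" if "x \<in> space M - E1" "y \<in> space M - E1" for x y
  proof -
    have "z \<in> B' B \<longleftrightarrow> z \<in> B" if "B \<in> space M // R" "z \<in> space M - E1" for B z
      using that by (auto simp: E1_def)
    then have "(x, y) \<in> S1 \<longleftrightarrow> (\<forall>B\<in>space M // R. x \<in> B \<longleftrightarrow> y \<in> B)"
      using that by (simp add: S1_def)
    also have "\<dots> \<longleftrightarrow> (x, y) \<in> R"
    proof
      assume *: "\<forall>B\<in>space M // R. x \<in> B \<longleftrightarrow> y \<in> B"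
      have "R `` {x} \<in> space M // R" using that by (auto intro: quotientI)
      with * have "x \<in> R `` {x} \<longleftrightarrow> y \<in> R `` {x}" by (rule bspec)
      then show "(x, y) \<in> R" using that R'(5) by simp
    next
      assume xy: "(x, y) \<in> R"
      show "\<forall>B\<in>space M // R. x \<in> B \<longleftrightarrow> y \<in> B"
        using saturated_iff[OF saturated_class[OF R'(1)] xy R'(6)[OF xy]] by (rule ballI)
    qed
    finally show ?thesis .
  qed

  define EL where "EL = (\<Union>g\<in>ball l. T g ` E1)"
  have ELM: "EL \<in> sets M"
    unfolding EL_def using finite_ball T_image_sets(1)[OF _ E1M] ball_closed by (intro sets.finite_UN) auto
  have "prob EL \<le> (\<Sum>g\<in>ball l. prob (T g ` E1))"
    unfolding EL_def using finite_ball T_image_sets(1)[OF _ E1M] ball_closed by (intro measure_UNION_le) auto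
  also have "\<dots> = N * prob E1"
    using T_image_sets(2)[OF _ E1M] ball_closed by (simp add: N_def subset_iff)
  also have "\<dots> \<le> e / 2"
    using e1(3) mult_left_mono[of "prob E1" e1 N] E1 by (simp add: N_def)
  finally have EL: "prob EL \<le> e / 2" .
  have agreeL: "(x, y) \<in> refine S1 (ball l) \<longleftrightarrow> (x, y) \<in> refine R (ball l)"
    if "x \<in> space M - EL" "y \<in> space M - EL" for x y
  proof -
    have *: "T (inv g) z \<in> space M - E1" if "g \<in> ball l" "z \<in> space M - EL" for g z
    proof -
      have g: "g \<in> carrier G" using that ball_closed by auto
      have "z \<notin> T g ` E1" using that by (auto simp: EL_def)
      then show ?thesis
        using that g T_inv(2)[OF g, of z] by (auto simp: T_closed image_iff)
    qed
    have "(T (inv g) x, T (inv g) y) \<in> S1 \<longleftrightarrow> (T (inv g) x, T (inv g) y) \<in> R" if "g \<in> ball l" for g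
      using agree[OF *[OF that] *[OF that]] \<open>x \<in> space M - EL\<close> \<open>y \<in> space M - EL\<close> by blast
    then show ?thesis unfolding refine_def by auto
  qed

  let ?S1l = "refine S1 (ball l)"
  note S1l = meas_equivD[OF meas_equiv_refine_ball[OF S1, of l]]
  \<comment> \<open>\<open>A'' A\<close> replaces \<open>A' A\<close>: it is saturated for \<open>?S1l\<close>, which makes \<open>E3\<close> saturated for a ball
    refinement of \<open>C\<close>, and it differs from \<open>A' A\<close> inside \<open>EL\<close> only.\<close>
  define A'' where "A'' A = ?S1l `` (A' A - EL)" for A
  have A'': "saturated ?S1l (A'' A)" for A
    unfolding saturated_def A''_def using S1l(4,7) by blast
  have A''_iff: "x \<in> A'' A \<longleftrightarrow> x \<in> A' A" if A: "A \<in> space M // C" and x: "x \<in> space M - EL" for A x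
  proof
    assume "x \<in> A'' A"
    then obtain y where y: "y \<in> A' A - EL" "(y, x) \<in> ?S1l" by (auto simp: A''_def)
    then have "(y, x) \<in> refine R (ball l)" using agreeL[of y x] x S1l(4) by auto
    then show "x \<in> A' A" using A'[OF A] y by (auto simp: saturated_def)
  next
    assume "x \<in> A' A"
    then show "x \<in> A'' A" using x S1l(5)[of x] by (auto simp: A''_def)
  qed
  \<comment> \<open>Outside \<open>E3\<close> the relation \<open>?S1l\<close> determines the class of \<open>C\<close>; on \<open>E3\<close> this class is recorded.\<close>
  define E3 where "E3 = (\<Union>A\<in>space M // C. (A - A'' A) \<union> (A'' A - A))"
  have E3M: "E3 \<in> sets M"
    unfolding E3_def using C'(2,3) saturated_refine_sets[OF S1 A''] by (intro sets.finite_UN) auto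
  have "E3 \<subseteq> E2 \<union> EL"
  proof
    fix x assume "x \<in> E3"
    then obtain A where A: "A \<in> space M // C" "x \<in> (A - A'' A) \<union> (A'' A - A)" by (auto simp: E3_def)
    have "A \<subseteq> space M" "A'' A \<subseteq> space M"
      using C'(3)[OF A(1)] sets.sets_into_space A'' by (auto simp: saturated_def)
    then have x: "x \<in> space M" using A(2) by auto
    show "x \<in> E2 \<union> EL"
    proof (cases "x \<in> EL")
      case False
      then have "x \<in> (A - A' A) \<union> (A' A - A)" using A A''_iff[OF A(1), of x] x by auto
      then show ?thesis using A(1) by (auto simp: E2_def)
    qed simp
  qed
  then have "prob E3 \<le> prob (E2 \<union> EL)" using E2M ELM by (intro finite_measure_mono) auto
  also have "\<dots> \<le> prob E2 + prob EL" using E2M ELM by (intro measure_Un_le)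
  finally have E3: "prob E3 \<le> e" using E2 EL by linarith

  define D where "D = localize M E3 C"
  define S where "S = S1 \<inter> D"
  have D: "meas_equiv M D" unfolding D_def by (intro meas_equiv_localize Cm E3M)
  have S: "meas_equiv M S" unfolding S_def by (intro meas_equiv_Int S1 D)
  have S_C: "refine S (ball l) \<subseteq> C"
  proof (rule subrelI)
    fix x y assume xy: "(x, y) \<in> refine S (ball l)"
    have "(x, y) \<in> S" using xy refine_subset[OF meas_equivD(4)[OF S] one_in_ball] by blast
    then have xyD: "(x, y) \<in> D" by (simp add: S_def)
    have xyS1: "(x, y) \<in> ?S1l" using xy refine_mono[of S S1 "ball l" "ball l"] by (auto simp: S_def)
    show "(x, y) \<in> C"
    proof (cases "x \<in> E3")
      case True
      then show ?thesis using xyD by (auto simp: D_def localize_def)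
    next
      case False
      then have xy3: "x \<notin> E3" "y \<notin> E3" "x \<in> space M" using xyD by (auto simp: D_def localize_def)
      have A: "C `` {x} \<in> space M // C" using xy3 by (auto intro: quotientI)
      have "x \<in> C `` {x}" using xy3 C'(5) by auto
      then have "x \<in> A'' (C `` {x})" using A xy3 by (auto simp: E3_def)
      then have "y \<in> A'' (C `` {x})" using A''[of "C `` {x}"] xyS1 by (auto simp: saturated_def)
      then have "y \<in> C `` {x}" using A xy3 by (auto simp: E3_def)
      then show ?thesis by simp
    qed
  qed
  have C_S: "refine C (ball (l + m)) \<subseteq> S"
  proof -
    let ?C = "refine C (ball (l + m))"
    have 1: "?C \<subseteq> refine C (ball m)" by (intro refine_mono ball_mono) auto
    have 2: "?C \<subseteq> C" by (intro refine_subset C'(4) one_in_ball)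
    have "?C \<subseteq> refine (refine C (ball m)) (ball l)"
      unfolding refine_refine[OF ball_closed ball_closed] by (intro refine_mono order_refl ball_mult)
    also have "\<dots> \<subseteq> ?S1l" using C_S1 by (intro refine_mono order_refl)
    finally have 3: "?C \<subseteq> ?S1l" .
    note Cl = meas_equivD[OF meas_equiv_refine_ball[OF Cm, of "l + m"]]
    have "?C \<subseteq> D"
    proof (rule subrelI)
      fix x y assume xy: "(x, y) \<in> ?C"
      have yx: "(y, x) \<in> ?C" using xy Cl(6) by blast
      have "x \<in> A \<longleftrightarrow> y \<in> A" if "A \<in> space M // C" for A
        using saturated_iff[OF saturated_mono[OF saturated_class[OF C'(1) that] 2] xy yx] .
      moreover have "x \<in> A'' A \<longleftrightarrow> y \<in> A'' A" for A
        using saturated_iff[OF saturated_mono[OF A'' 3] xy yx] .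
      ultimately have "x \<in> E3 \<longleftrightarrow> y \<in> E3" by (simp add: E3_def)
      then show "(x, y) \<in> D" using xy 2 C'(4) by (auto simp: D_def localize_def)
    qed
    then show ?thesis using 1 C_S1 by (auto simp: S_def)
  qed

  define Z where "Z = localize M E1 S1 \<inter> D"
  have L1: "meas_equiv M (localize M E1 S1)" and LR: "meas_equiv M (localize M E1 R)"
    by (intro meas_equiv_localize S1 Rm E1M)+
  have Z: "meas_equiv M Z" unfolding Z_def by (intro meas_equiv_Int L1 D)
  have "equiv_entropy M Z \<le> equiv_entropy M (localize M E1 S1) + equiv_entropy M D"
    unfolding Z_def by (intro equiv_entropy_Int_le L1 D)
  also have "\<dots> \<le> \<epsilon>' + \<epsilon>'"
    unfolding D_def using E1 e1 by (intro add_mono small S1 card_S1 E1M Cm k E3M E3) auto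
  finally have HZ: "equiv_entropy M Z \<le> 2 * \<epsilon>'" by simp
  have HY: "equiv_entropy M (localize M E1 R) \<le> \<epsilon>'"
    using E1 e1 by (intro small Rm k E1M) auto
  have RZ: "R \<inter> Z \<subseteq> S"
    using agree by (auto simp: Z_def S_def localize_def)
  have SY: "S \<inter> localize M E1 R \<subseteq> R"
    using agree by (auto simp: S_def localize_def)
  have "F S \<le> F R + 2 * real r * equiv_entropy M (localize M E1 R) + (2 * real r + 1) * equiv_entropy M Z"
    by (intro F_perturbation Rm S Z LR RZ SY)
  also have "\<dots> \<le> F R + 2 * real r * \<epsilon>' + (2 * real r + 1) * (2 * \<epsilon>')"
    using HZ HY by (intro add_mono mult_left_mono order_refl) auto
  also have "\<dots> = F R + (6 * real r + 2) * \<epsilon>'" by (simp add: algebra_simps)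
  also have "\<dots> = F R + \<epsilon>" by (simp add: \<epsilon>'_def add_nonneg_pos less_imp_neq[symmetric])
  finally show ?thesis using S S_C C_S by blast
qed

text \<open>
  The counterpart of \<open>f_partition\<close> for equivalence relations; see \<open>f_partition_same_cell\<close>.
\<close>

definition f_rel :: "('x \<times> 'x) set \<Rightarrow> ereal" where
  "f_rel R = (INF n. ereal (F (refine R (ball n))))"

lemma f_rel_le_F:
  assumes R: "generates R" and C: "generates C"
  shows "f_rel C \<le> ereal (F R)"
proof (rule ereal_le_epsilon2)
  fix \<epsilon> :: real assume "0 < \<epsilon>"
  then obtain S l m where S: "meas_equiv M S" "refine S (ball l) \<subseteq> C" "refine C (ball m) \<subseteq> S" "F S \<le> F R + \<epsilon>"
    using ex_equivalent_perturbation[OF R C] by blast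
  have "f_rel C \<le> ereal (F (refine C (ball (l + m))))"
    unfolding f_rel_def by (intro INF_lower) simp
  also have "\<dots> \<le> ereal (F S)"
    using F_refine_le_of_equivalent[OF S(1) _ S(2,3)] C by (simp add: generates_def)
  also have "\<dots> \<le> ereal (F R) + ereal \<epsilon>" using S(4) by simp
  finally show "f_rel C \<le> ereal (F R) + ereal \<epsilon>" .
qed

lemma generates_refine:
  assumes "generates R"
  shows "generates (refine R (ball n))"
proof -
  have R: "meas_equiv M R" using assms by (simp add: generates_def)
  have "refine (refine R (ball n)) (ball k) \<subseteq> refine R (ball k)" for k
    by (intro refine_mono refine_subset meas_equivD(4)[OF R] one_in_ball order_refl)
  then have "saturated (refine (refine R (ball n)) (ball k)) B" if "saturated (refine R (ball k)) B" for k B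
    using that saturated_mono by blast
  then show ?thesis
    using assms meas_equiv_refine_ball[OF R] unfolding generates_def approximable_def by blast
qed

lemma f_rel_unique:
  assumes "generates R" "generates C"
  shows "f_rel R = f_rel C"
proof -
  have le: "f_rel C \<le> f_rel R" if "generates R" "generates C" for R C
    unfolding f_rel_def[of R] by (intro INF_greatest f_rel_le_F generates_refine that)
  show ?thesis using le[OF assms] le[OF assms(2,1)] by simp
qed

end

section \<open>Partitions and equivalence relations\<close>

text \<open>
  The equivalence relation whose classes are the nonempty members of \<open>\<alpha>\<close>.
\<close>

definition same_cell :: "'x set set \<Rightarrow> ('x \<times> 'x) set" where
  "same_cell \<alpha> = {(x, y). \<exists>A\<in>\<alpha>. x \<in> A \<and> y \<in> A}"

text \<open>
  A family of disjoint sets with union \<open>X\<close>; finiteness and measurability are obtained separately,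
  from the associated relation.
\<close>

definition disjoint_cover :: "'x set \<Rightarrow> 'x set set \<Rightarrow> bool" where
  "disjoint_cover X \<alpha> \<longleftrightarrow> \<Union>\<alpha> = X \<and> (\<forall>A\<in>\<alpha>. \<forall>B\<in>\<alpha>. \<forall>x. x \<in> A \<longrightarrow> x \<in> B \<longrightarrow> A = B)"

lemma disjoint_cover_finite_partition: "finite_partition M \<alpha> \<Longrightarrow> disjoint_cover (space M) \<alpha>"
  unfolding finite_partition_def disjoint_cover_def by (meson disjnt_iff pairwiseD)

lemma same_cell_class:
  assumes "disjoint_cover X \<alpha>" "A \<in> \<alpha>" "x \<in> A"
  shows "same_cell \<alpha> `` {x} = A"
  using assms unfolding disjoint_cover_def same_cell_def by blast

lemma equiv_same_cell:
  assumes "disjoint_cover X \<alpha>"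
  shows "equiv X (same_cell \<alpha>)"
proof (rule equivI)
  show "same_cell \<alpha> \<subseteq> X \<times> X" "refl_on X (same_cell \<alpha>)" "sym (same_cell \<alpha>)"
    using assms unfolding disjoint_cover_def same_cell_def refl_on_def sym_def by blast+
  show "trans (same_cell \<alpha>)"
  proof (rule transI)
    fix x y z assume "(x, y) \<in> same_cell \<alpha>" "(y, z) \<in> same_cell \<alpha>"
    then obtain A B where AB: "A \<in> \<alpha>" "B \<in> \<alpha>" "x \<in> A" "y \<in> A" "y \<in> B" "z \<in> B"
      by (auto simp: same_cell_def)
    then have "A = B" using assms unfolding disjoint_cover_def by simp
    then show "(x, z) \<in> same_cell \<alpha>" using AB by (auto simp: same_cell_def)
  qed
qed

lemma quotient_same_cell:
  assumes "disjoint_cover X \<alpha>"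
  shows "X // same_cell \<alpha> = \<alpha> - {{}}"
proof
  show "X // same_cell \<alpha> \<subseteq> \<alpha> - {{}}"
  proof
    fix C assume "C \<in> X // same_cell \<alpha>"
    then obtain x where x: "x \<in> X" "C = same_cell \<alpha> `` {x}" by (rule quotientE)
    then obtain A where "A \<in> \<alpha>" "x \<in> A" using assms by (auto simp: disjoint_cover_def)
    then show "C \<in> \<alpha> - {{}}" using same_cell_class[OF assms] x by auto
  qed
  show "\<alpha> - {{}} \<subseteq> X // same_cell \<alpha>"
  proof
    fix A assume "A \<in> \<alpha> - {{}}"
    then obtain x where x: "A \<in> \<alpha>" "x \<in> A" by auto
    then have "x \<in> X" using assms by (auto simp: disjoint_cover_def)
    then show "A \<in> X // same_cell \<alpha>" using same_cell_class[OF assms x] by (metis quotientI)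
  qed
qed

lemma meas_equiv_same_cell:
  assumes "finite_partition M \<alpha>"
  shows "meas_equiv M (same_cell \<alpha>)"
  using assms disjoint_cover_finite_partition[OF assms]
  by (auto simp: meas_equiv_def equiv_same_cell quotient_same_cell finite_partition_def)

lemma partition_entropy_same_cell:
  assumes "disjoint_cover (space M) \<alpha>" "meas_equiv M (same_cell \<alpha>)"
  shows "partition_entropy M \<alpha> = equiv_entropy M (same_cell \<alpha>)"
proof -
  have "finite \<alpha>" using meas_equivD(2)[OF assms(2)] by (simp add: quotient_same_cell[OF assms(1)])
  then show ?thesis
    unfolding equiv_entropy_def partition_entropy_def quotient_same_cell[OF assms(1)]
    by (auto intro!: sum.mono_neutral_right)
qed

lemma disjoint_cover_join:
  assumes "disjoint_cover X \<alpha>" "disjoint_cover X \<beta>"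
  shows "disjoint_cover X (join \<alpha> \<beta>)"
  unfolding disjoint_cover_def
proof (intro conjI ballI allI impI)
  show "\<Union>(join \<alpha> \<beta>) = X"
  proof -
    have "\<Union>(join \<alpha> \<beta>) = \<Union>\<alpha> \<inter> \<Union>\<beta>" unfolding join_def by blast
    then show ?thesis using assms by (simp add: disjoint_cover_def)
  qed
  fix P Q x assume "P \<in> join \<alpha> \<beta>" "Q \<in> join \<alpha> \<beta>" "x \<in> P" "x \<in> Q"
  then obtain A B A' B' where "P = A \<inter> B" "Q = A' \<inter> B'" "x \<in> A" "x \<in> B" "x \<in> A'" "x \<in> B'"
    and AB: "A \<in> \<alpha>" "A' \<in> \<alpha>" "B \<in> \<beta>" "B' \<in> \<beta>" unfolding join_def by blast
  moreover have "A = A'" "B = B'"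
    using assms calculation AB unfolding disjoint_cover_def by simp_all
  ultimately show "P = Q" by simp
qed

lemma same_cell_join: "same_cell (join \<alpha> \<beta>) = same_cell \<alpha> \<inter> same_cell \<beta>"
  unfolding same_cell_def join_def by auto

lemma disjoint_cover_Join:
  assumes "\<And>i. i \<in> I \<Longrightarrow> disjoint_cover X (\<alpha> i)" "I \<noteq> {}"
  shows "disjoint_cover X (Join I \<alpha>)"
  unfolding disjoint_cover_def
proof (intro conjI ballI allI impI)
  have "\<Union>(\<alpha> i) = X" if "i \<in> I" for i using assms(1)[OF that] by (simp add: disjoint_cover_def)
  then have cell: "\<exists>A\<in>\<alpha> i. x \<in> A" if "i \<in> I" "x \<in> X" for i x using that by blast
  show "\<Union>(Join I \<alpha>) = X"
  proof
    show "\<Union>(Join I \<alpha>) \<subseteq> X"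
      using assms(2) \<open>\<And>i. i \<in> I \<Longrightarrow> \<Union>(\<alpha> i) = X\<close> unfolding Join_def by blast
    show "X \<subseteq> \<Union>(Join I \<alpha>)"
    proof
      fix x assume "x \<in> X"
      then have "\<forall>i\<in>I. \<exists>A. A \<in> \<alpha> i \<and> x \<in> A" using cell by blast
      then obtain A where "\<forall>i\<in>I. A i \<in> \<alpha> i \<and> x \<in> A i" by metis
      then show "x \<in> \<Union>(Join I \<alpha>)" unfolding Join_def by blast
    qed
  qed
  fix P Q x assume "P \<in> Join I \<alpha>" "Q \<in> Join I \<alpha>" "x \<in> P" "x \<in> Q"
  then obtain A B where "P = (\<Inter>i\<in>I. A i)" "Q = (\<Inter>i\<in>I. B i)" and AB: "\<And>i. i \<in> I \<Longrightarrow> A i \<in> \<alpha> i"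
    "\<And>i. i \<in> I \<Longrightarrow> B i \<in> \<alpha> i" "\<And>i. i \<in> I \<Longrightarrow> x \<in> A i" "\<And>i. i \<in> I \<Longrightarrow> x \<in> B i"
    unfolding Join_def by blast
  moreover have "A i = B i" if "i \<in> I" for i
    using assms(1)[OF that] AB[OF that] unfolding disjoint_cover_def by simp
  ultimately show "P = Q" by simp
qed

lemma same_cell_Join: "same_cell (Join I \<alpha>) = {(x, y). \<forall>i\<in>I. (x, y) \<in> same_cell (\<alpha> i)}"
proof (intro subset_antisym subrelI CollectI case_prodI ballI)
  fix x y i assume "(x, y) \<in> same_cell (Join I \<alpha>)" and i: "i \<in> I"
  then obtain A where "\<forall>i\<in>I. A i \<in> \<alpha> i" "x \<in> (\<Inter>i\<in>I. A i)" "y \<in> (\<Inter>i\<in>I. A i)"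
    unfolding same_cell_def Join_def by blast
  then have "A i \<in> \<alpha> i" "x \<in> A i" "y \<in> A i" using i by simp_all
  then show "(x, y) \<in> same_cell (\<alpha> i)" by (auto simp: same_cell_def)
next
  fix x y assume "(x, y) \<in> {(x, y). \<forall>i\<in>I. (x, y) \<in> same_cell (\<alpha> i)}"
  then have "\<forall>i\<in>I. \<exists>A. A \<in> \<alpha> i \<and> x \<in> A \<and> y \<in> A" by (auto simp: same_cell_def)
  then obtain A where A: "\<forall>i\<in>I. A i \<in> \<alpha> i \<and> x \<in> A i \<and> y \<in> A i" by metis
  then have "(\<Inter>i\<in>I. A i) \<in> Join I \<alpha>" unfolding Join_def by blast
  moreover have "x \<in> (\<Inter>i\<in>I. A i)" "y \<in> (\<Inter>i\<in>I. A i)" using A by simp_all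
  ultimately show "(x, y) \<in> same_cell (Join I \<alpha>)" unfolding same_cell_def by blast
qed

context finitely_generated_action
begin

lemma same_cell_translate:
  assumes "g \<in> carrier G" "\<Union>\<alpha> = space M"
  shows "same_cell (translate T g \<alpha>) = shift_rel g (same_cell \<alpha>)"
proof -
  have "T g ` A = T (inv g) -` A \<inter> space M" if "A \<in> \<alpha>" for A
    using that assms(2) by (intro T_image_eq[OF assms(1)]) auto
  then show ?thesis
    by (auto simp: same_cell_def translate_def shift_rel_def)
qed

lemma disjoint_cover_translate:
  assumes g: "g \<in> carrier G" and \<alpha>: "disjoint_cover (space M) \<alpha>"
  shows "disjoint_cover (space M) (translate T g \<alpha>)"
proof -
  have eq: "T g ` A = T (inv g) -` A \<inter> space M" if "A \<in> \<alpha>" for A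
    using that \<alpha> unfolding disjoint_cover_def by (intro T_image_eq[OF g]) auto
  have sp: "\<Union>\<alpha> = space M" using \<alpha> by (simp add: disjoint_cover_def)
  have "\<Union>(translate T g \<alpha>) = T g ` space M" unfolding translate_def sp[symmetric] by auto
  also have "\<dots> = space M"
    using T_image_eq[OF g order_refl] g by (auto simp: T_closed)
  finally show ?thesis
    using \<alpha> unfolding disjoint_cover_def translate_def by (simp add: eq) metis
qed

lemma F_partition_same_cell:
  assumes "disjoint_cover (space M) \<alpha>" "meas_equiv M (same_cell \<alpha>)"
  shows "F_partition r s M T \<alpha> = F (same_cell \<alpha>)"
proof -
  have "partition_entropy M (join \<alpha> (translate T (s i) \<alpha>))
      = equiv_entropy M (same_cell \<alpha> \<inter> shift_rel (s i) (same_cell \<alpha>))" if i: "i \<in> {1..r}" for i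
  proof -
    note si = gen_closed[OF i]
    have eq: "same_cell (join \<alpha> (translate T (s i) \<alpha>)) = same_cell \<alpha> \<inter> shift_rel (s i) (same_cell \<alpha>)"
      using assms(1) by (simp add: same_cell_join same_cell_translate[OF si] disjoint_cover_def)
    show ?thesis
      by (subst partition_entropy_same_cell)
         (auto simp: eq intro!: disjoint_cover_join disjoint_cover_translate si assms
            meas_equiv_Int meas_equiv_shift_rel)
  qed
  then show ?thesis
    unfolding F_partition_def F_def by (simp add: partition_entropy_same_cell[OF assms])
qed

lemma ball_refinement_same_cell:
  assumes "disjoint_cover (space M) \<alpha>"
  shows "same_cell (ball_refinement G r s T \<alpha> n) = refine (same_cell \<alpha>) (ball n)"
    and "disjoint_cover (space M) (ball_refinement G r s T \<alpha> n)"
proof -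
  have sp: "\<Union>\<alpha> = space M" using assms by (simp add: disjoint_cover_def)
  have ne: "ball n \<noteq> {}" using one_in_ball by auto
  have bc: "g \<in> carrier G" if "g \<in> ball n" for g using that ball_closed by auto
  show "same_cell (ball_refinement G r s T \<alpha> n) = refine (same_cell \<alpha>) (ball n)"
    unfolding ball_refinement_def same_cell_Join refine_def
    using ne by (auto simp: same_cell_translate[OF bc sp] shift_rel_def)
  show "disjoint_cover (space M) (ball_refinement G r s T \<alpha> n)"
    unfolding ball_refinement_def
    by (intro disjoint_cover_Join disjoint_cover_translate bc assms ne)
qed

lemma f_partition_same_cell:
  assumes "finite_partition M \<alpha>"
  shows "f_partition G r s M T \<alpha> = f_rel (same_cell \<alpha>)"
proof -
  note dc = disjoint_cover_finite_partition[OF assms]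
  show ?thesis
    unfolding f_partition_def f_rel_def
    using meas_equiv_refine_ball[OF meas_equiv_same_cell[OF assms]]
    by (simp add: F_partition_same_cell ball_refinement_same_cell[OF dc])
qed

lemma generates_same_cell:
  assumes "generating_partition G M T \<alpha>"
  shows "generates (same_cell \<alpha>)"
proof -
  have fp: "finite_partition M \<alpha>" using assms by (simp add: generating_partition_def)
  note R = meas_equiv_same_cell[OF fp]
  have sat: "saturated (same_cell \<alpha>) A" if "A \<in> \<alpha>" for A
    using disjoint_cover_finite_partition[OF fp] that
    unfolding saturated_def disjoint_cover_def same_cell_def by blast
  have "approximable (same_cell \<alpha>) A" if A: "A \<in> sets M" for A
  proof (rule approximable_limit[OF R A])
    obtain B where B: "B \<in> invariant_sigma G M T \<alpha>" "(A - B) \<union> (B - A) \<in> null_sets M"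
      using assms A unfolding generating_partition_def by blast
    have "approximable (same_cell \<alpha>) B" using invariant_sigma_approximable[OF R sat B(1)] .
    moreover have "prob ((A - B) \<union> (B - A)) = 0" using B(2) by (simp add: measure_eq_0_null_sets)
    ultimately show "\<exists>B. approximable (same_cell \<alpha>) B \<and> prob ((A - B) \<union> (B - A)) < \<epsilon>" if "0 < \<epsilon>" for \<epsilon>
      using that by (intro exI[of _ B]) auto
  qed
  then show ?thesis using R by (simp add: generates_def)
qed

theorem f_partition_unique:
  assumes "generating_partition G M T \<alpha>" "generating_partition G M T \<beta>"
  shows "f_partition G r s M T \<alpha> = f_partition G r s M T \<beta>"
proof -
  have "finite_partition M \<alpha>" "finite_partition M \<beta>" using assms by (auto simp: generating_partition_def)
  then show ?thesis
    using f_rel_unique[OF generates_same_cell[OF assms(1)] generates_same_cell[OF assms(2)]]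
    by (simp add: f_partition_same_cell)
qed

lemma f_invariant_eq:
  assumes "generating_partition G M T \<alpha>"
  shows "f_invariant G r s M T = f_partition G r s M T \<alpha>"
  unfolding f_invariant_def
  by (rule the_equality) (use assms f_partition_unique in blast)+

end

section \<open>The Bernoulli action of a free group\<close>

text \<open>
  The shift action of the free group \<open>G\<close> on \<open>K\<close>-valued functions, with a product measure.
\<close>

locale free_bernoulli =
  fixes G :: "('g, 'm) monoid_scheme" (structure) and r :: nat and s :: "nat \<Rightarrow> 'g"
    and K :: "'k set" and \<kappa> :: "'k measure"
  assumes free: "free_group_on G r s"
    and finite_K: "finite K"
    and prob_space_base: "prob_space \<kappa>"
    and space_base: "space \<kappa> = K"
    and sets_base: "sets \<kappa> = Pow K"
begin

abbreviation \<mu> where "\<mu> \<equiv> bernoulli_measure G \<kappa>"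

lemma space_bernoulli: "space \<mu> = (\<Pi>\<^sub>E g\<in>carrier G. K)"
  by (simp add: bernoulli_measure_def space_PiM space_base)

lemma group_G: "group G"
  using free by (simp add: free_group_on_def)

lemma finitely_generated_action_bernoulli: "finitely_generated_action \<mu> G (bernoulli_shift G) r s"
proof -
  interpret group G by (rule group_G)
  interpret prob_space \<mu>
    unfolding bernoulli_measure_def using prob_space_base by (intro prob_space_PiM)
  show ?thesis
  proof unfold_locales
    fix g assume g: "g \<in> carrier G"
    show "bernoulli_shift G g \<in> measurable \<mu> \<mu>"
      unfolding bernoulli_measure_def bernoulli_shift_def
      using g by (intro measurable_restrict measurable_component_singleton) auto
    show "distr \<mu> \<mu> (bernoulli_shift G g) = \<mu>"
      unfolding bernoulli_measure_def bernoulli_shift_def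
      using distr_PiM_reindex[of "carrier G" "\<lambda>_. \<kappa>" "\<lambda>h. inv g \<otimes> h" "carrier G"] prob_space_base g
      by (auto simp: inj_on_def)
    fix h x assume h: "h \<in> carrier G" and x: "x \<in> space \<mu>"
    show "bernoulli_shift G (g \<otimes> h) x = bernoulli_shift G g (bernoulli_shift G h x)"
      unfolding bernoulli_shift_def using g h by (auto simp: inv_mult_group m_assoc restrict_def)
  next
    fix x assume "x \<in> space \<mu>"
    then show "bernoulli_shift G \<one> x = x"
      by (auto simp: bernoulli_shift_def space_bernoulli restrict_def PiE_def extensional_def fun_eq_iff)
  next
    show "s ` {1..r} \<subseteq> carrier G" using free by (simp add: free_group_on_def)
  next
    fix g assume "g \<in> carrier G"
    then have "g \<in> (\<lambda>ws. word_prod G (map (letter G s) ws)) ` reduced_words r"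
      using free by (simp add: free_group_on_def bij_betw_def)
    then obtain ws where ws: "ws \<in> reduced_words r" "g = word_prod G (map (letter G s) ws)" by auto
    then have "set ws \<subseteq> {1..r} \<times> UNIV" by (simp add: reduced_words_def)
    moreover have "letter G s (i, b) \<in> sym_gens G r s" if "i \<in> {1..r}" for i b
      using that by (simp add: letter_def sym_gens_def)
    ultimately have "set (map (letter G s) ws) \<subseteq> sym_gens G r s" by auto
    then show "\<exists>ws. set ws \<subseteq> sym_gens G r s \<and> word_prod G ws = g" using ws by blast
  qed
qed

end

sublocale free_bernoulli \<subseteq> finitely_generated_action \<mu> G "bernoulli_shift G" r s
  by (rule finitely_generated_action_bernoulli)

context free_bernoulli
begin

abbreviation T where "T \<equiv> bernoulli_shift G"

text \<open>
  The partition according to the value at the identity.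
\<close>

definition canonical_partition :: "('g \<Rightarrow> 'k) set set" where
  "canonical_partition = (\<lambda>k. {x \<in> space \<mu>. x \<one> = k}) ` K"

lemma shift_cylinder:
  assumes "g \<in> carrier G"
  shows "T g ` {x \<in> space \<mu>. x \<one> = k} = {x \<in> space \<mu>. x g = k}"
proof -
  have "T g ` {x \<in> space \<mu>. x \<one> = k} = T (inv g) -` {x \<in> space \<mu>. x \<one> = k} \<inter> space \<mu>"
    by (intro T_image_eq assms) auto
  also have "\<dots> = {x \<in> space \<mu>. x g = k}"
    using assms T_closed[of "inv g"] by (auto simp: bernoulli_shift_def)
  finally show ?thesis .
qed

lemma coordinate_sets:
  assumes "g \<in> carrier G" "A \<subseteq> K"
  shows "{x \<in> space \<mu>. x g \<in> A} \<in> sets \<mu>"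
proof -
  have "(\<lambda>x. x g) \<in> measurable \<mu> \<kappa>"
    unfolding bernoulli_measure_def by (intro measurable_component_singleton assms)
  then have "(\<lambda>x. x g) -` A \<inter> space \<mu> \<in> sets \<mu>"
    using assms(2) by (intro measurable_sets) (auto simp: sets_base)
  moreover have "(\<lambda>x. x g) -` A \<inter> space \<mu> = {x \<in> space \<mu>. x g \<in> A}" by auto
  ultimately show ?thesis by simp
qed

lemma finite_partition_canonical: "finite_partition \<mu> canonical_partition"
  unfolding finite_partition_def
proof (intro conjI)
  show "finite canonical_partition" using finite_K by (simp add: canonical_partition_def)
  show "canonical_partition \<subseteq> sets \<mu>"
    using coordinate_sets[of \<one> "{_}"] by (auto simp: canonical_partition_def)
  show "pairwise disjnt canonical_partition"
    by (auto simp: canonical_partition_def pairwise_def disjnt_def)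
  show "\<Union>canonical_partition = space \<mu>"
    by (auto simp: canonical_partition_def space_bernoulli)
qed

lemma generating_canonical: "generating_partition G \<mu> T canonical_partition"
  unfolding generating_partition_def
proof (intro conjI ballI finite_partition_canonical)
  fix A assume A: "A \<in> sets \<mu>"
  have "A \<in> \<Sigma>" if \<Sigma>: "sigma_algebra (space \<mu>) \<Sigma>" "canonical_partition \<subseteq> \<Sigma>"
    "\<And>g A. g \<in> carrier G \<Longrightarrow> A \<in> \<Sigma> \<Longrightarrow> T g ` A \<in> \<Sigma>" for \<Sigma>
  proof -
    interpret \<Sigma>: sigma_algebra "space \<mu>" \<Sigma> by (rule \<Sigma>(1))
    have cyl: "{x \<in> space \<mu>. x g \<in> B} \<in> \<Sigma>" if "g \<in> carrier G" "B \<subseteq> K" for g B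
    proof -
      have "{x \<in> space \<mu>. x g = k} \<in> \<Sigma>" if "k \<in> B" for k
        using \<Sigma>(3)[OF \<open>g \<in> carrier G\<close>] \<Sigma>(2) that \<open>B \<subseteq> K\<close>
        by (subst shift_cylinder[symmetric]) (auto simp: canonical_partition_def \<open>g \<in> carrier G\<close>)
      then have "(\<Union>k\<in>B. {x \<in> space \<mu>. x g = k}) \<in> \<Sigma>"
        using finite_subset[OF that(2) finite_K] by (intro \<Sigma>.finite_UN) auto
      moreover have "(\<Union>k\<in>B. {x \<in> space \<mu>. x g = k}) = {x \<in> space \<mu>. x g \<in> B}" by auto
      ultimately show ?thesis by simp
    qed
    have "A \<in> sigma_sets (space \<mu>) {{x \<in> space \<mu>. x g \<in> B} | g B. g \<in> carrier G \<and> B \<in> sets \<kappa>}"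
      using A unfolding bernoulli_measure_def sets_PiM_single space_PiM by simp
    also have "\<dots> \<subseteq> \<Sigma>"
      using cyl by (intro \<Sigma>.sigma_sets_subset) (auto simp: sets_base)
    finally show ?thesis .
  qed
  then have "A \<in> invariant_sigma G \<mu> T canonical_partition"
    unfolding invariant_sigma_def by blast
  then show "\<exists>B\<in>invariant_sigma G \<mu> T canonical_partition. (A - B) \<union> (B - A) \<in> null_sets \<mu>"
    by (intro bexI[of _ A]) auto
qed

text \<open>
  Agreement of the coordinates in \<open>W\<close>; this is the refinement of the canonical partition by \<open>W\<close>.
\<close>

definition agree_on :: "'g set \<Rightarrow> (('g \<Rightarrow> 'k) \<times> ('g \<Rightarrow> 'k)) set" where
  "agree_on W = {(x, y) \<in> space \<mu> \<times> space \<mu>. \<forall>g\<in>W. x g = y g}"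

lemma same_cell_canonical: "same_cell canonical_partition = agree_on {\<one>}"
  by (auto simp: same_cell_def canonical_partition_def agree_on_def space_bernoulli)

lemma refine_agree_on:
  assumes "W \<subseteq> carrier G"
  shows "refine (agree_on {\<one>}) W = agree_on W"
proof -
  have "T (inv g) x \<one> = x g" if "g \<in> W" for g and x :: "'g \<Rightarrow> 'k"
    using that assms by (auto simp: bernoulli_shift_def)
  then show ?thesis using assms by (auto simp: refine_def agree_on_def T_closed subset_iff)
qed

lemma meas_equiv_agree_on:
  assumes "finite W" "W \<subseteq> carrier G"
  shows "meas_equiv \<mu> (agree_on W)"
  using meas_equiv_refine[OF assms meas_equiv_same_cell[OF finite_partition_canonical]]
  by (simp add: same_cell_canonical refine_agree_on[OF assms(2)])

lemma measure_agree_on_class: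
  assumes "finite W" "W \<subseteq> carrier G" "x \<in> space \<mu>"
  shows "measure \<mu> (agree_on W `` {x}) = (\<Prod>g\<in>W. measure \<kappa> {x g})"
proof -
  interpret P: product_prob_space "\<lambda>_. \<kappa>" "carrier G"
    by (intro product_prob_spaceI prob_space_base)
  have "agree_on W `` {x} = prod_emb (carrier G) (\<lambda>_. \<kappa>) W (\<Pi>\<^sub>E g\<in>W. {x g})"
    using assms(2,3) by (auto simp: agree_on_def prod_emb_def space_bernoulli space_base PiE_iff extensional_def)
  then show ?thesis
    using P.measure_PiM_emb[OF assms(2,1), of "\<lambda>g. {x g}"] assms(2,3)
    by (auto simp: bernoulli_measure_def[symmetric] sets_base space_bernoulli)
qed

lemma equiv_entropy_agree_on_one: "equiv_entropy \<mu> (agree_on {\<one>}) = base_entropy K \<kappa>"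
proof -
  have ne: "(\<lambda>g\<in>carrier G. k) \<in> {x \<in> space \<mu>. x \<one> = k}" if "k \<in> K" for k
    using that by (auto simp: space_bernoulli)
  have inj: "inj_on (\<lambda>k. {x \<in> space \<mu>. x \<one> = k}) K"
  proof (rule inj_onI)
    fix k k' assume k: "k \<in> K" and eq: "{x \<in> space \<mu>. x \<one> = k} = {x \<in> space \<mu>. x \<one> = k'}"
    have "(\<lambda>g\<in>carrier G. k) \<in> {x \<in> space \<mu>. x \<one> = k'}" using ne[OF k] by (simp only: eq)
    then show "k = k'" by simp
  qed
  have meas: "measure \<mu> {x \<in> space \<mu>. x \<one> = k} = measure \<kappa> {k}" if "k \<in> K" for k
  proof -
    let ?x = "\<lambda>g\<in>carrier G. k"
    have "agree_on {\<one>} `` {?x} = {x \<in> space \<mu>. x \<one> = k}"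
      using ne[OF that] by (auto simp: agree_on_def)
    then show ?thesis using measure_agree_on_class[of "{\<one>}" ?x] ne[OF that] by simp
  qed
  have "equiv_entropy \<mu> (agree_on {\<one>}) = partition_entropy \<mu> canonical_partition"
    using partition_entropy_same_cell[OF disjoint_cover_finite_partition[OF finite_partition_canonical]
        meas_equiv_same_cell[OF finite_partition_canonical]]
    by (simp add: same_cell_canonical)
  also have "\<dots> = base_entropy K \<kappa>"
    unfolding partition_entropy_def base_entropy_def canonical_partition_def
    by (simp add: sum.reindex[OF inj] meas)
  finally show ?thesis .
qed

text \<open>
  The measure of a class is the product of the measures of the classes of the single coordinates that
  contain it, so entropy is additive over the coordinates.
\<close>

lemma equiv_entropy_agree_on:
  assumes W: "finite W" "W \<subseteq> carrier G"
  shows "equiv_entropy \<mu> (agree_on W) = real (card W) * base_entropy K \<kappa>"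
proof -
  let ?Q = "space \<mu> // agree_on W"
  note m = meas_equiv_agree_on[OF W]
  have single: "meas_equiv \<mu> (agree_on {g})" "agree_on W \<subseteq> agree_on {g}" if "g \<in> W" for g
  proof -
    show "meas_equiv \<mu> (agree_on {g})" using that W by (intro meas_equiv_agree_on) auto
    show "agree_on W \<subseteq> agree_on {g}" using that by (auto simp: agree_on_def)
  qed
  have H1: "equiv_entropy \<mu> (agree_on {g}) = base_entropy K \<kappa>" if "g \<in> W" for g
  proof -
    have g: "g \<in> carrier G" using that W by auto
    have "agree_on {g} = shift_rel g (agree_on {\<one>})"
      using refine_agree_on[of "{g}"] g by (auto simp: refine_insert refine_empty shift_rel_def)
    then show ?thesis
      using equiv_entropy_shift_rel[OF g meas_equiv_agree_on[of "{\<one>}"]]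
      by (simp add: equiv_entropy_agree_on_one)
  qed
  have "prob D * ln (prob D) = (\<Sum>g\<in>W. prob D * ln (prob (agree_on {g} `` D)))" if Dq: "D \<in> ?Q" for D
  proof (cases "prob D = 0")
    case False
    obtain x where x: "x \<in> space \<mu>" "D = agree_on W `` {x}" using Dq by (rule quotientE)
    have D: "prob D = (\<Prod>g\<in>W. measure \<kappa> {x g})"
      using measure_agree_on_class[OF W x(1)] x(2) by simp
    have Dg: "prob (agree_on {g} `` D) = measure \<kappa> {x g}" if "g \<in> W" for g
    proof -
      have "agree_on {g} `` D = agree_on {g} `` {x}"
        unfolding x(2) using that
        by (intro equiv_Image_class[OF meas_equivD(1)[OF m] meas_equivD(1)[OF single(1)] single(2) x(1)])
      then show ?thesis using measure_agree_on_class[of "{g}" x] that W x(1) by auto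
    qed
    have "measure \<kappa> {x g} \<noteq> 0" if "g \<in> W" for g
      using False that W(1) unfolding D by (auto simp: prod_zero_iff)
    then have "ln (prob D) = (\<Sum>g\<in>W. ln (measure \<kappa> {x g}))"
      unfolding D using W(1) by (intro ln_prod) (auto simp: less_le)
    then show ?thesis by (simp add: Dg sum_distrib_left)
  qed simp
  then have "equiv_entropy \<mu> (agree_on W) = - (\<Sum>D\<in>?Q. \<Sum>g\<in>W. prob D * ln (prob (agree_on {g} `` D)))"
    by (simp add: equiv_entropy_def partition_entropy_def)
  also have "\<dots> = (\<Sum>g\<in>W. - (\<Sum>D\<in>?Q. prob D * ln (prob (agree_on {g} `` D))))"
    by (subst sum.swap) (simp add: sum_negf)
  also have "\<dots> = (\<Sum>g\<in>W. base_entropy K \<kappa>)"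
    using equiv_entropy_finer[OF m single] H1 by (intro sum.cong) auto
  finally show ?thesis by simp
qed

text \<open>
  The reduced word that represents \<open>g\<close>.
\<close>

definition normal_form :: "'g \<Rightarrow> (nat \<times> bool) list" where
  "normal_form = the_inv_into (reduced_words r) (\<lambda>ws. word_prod G (map (letter G s) ws))"

lemma normal_form:
  assumes "g \<in> carrier G"
  shows "normal_form g \<in> reduced_words r" "word_prod G (map (letter G s) (normal_form g)) = g"
proof -
  have b: "bij_betw (\<lambda>ws. word_prod G (map (letter G s) ws)) (reduced_words r) (carrier G)"
    using free by (simp add: free_group_on_def)
  show "normal_form g \<in> reduced_words r"
    unfolding normal_form_def using b assms by (intro the_inv_into_into) (auto simp: bij_betw_def)
  show "word_prod G (map (letter G s) (normal_form g)) = g"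
    unfolding normal_form_def using f_the_inv_into_f_bij_betw[OF b] assms by simp
qed

lemma normal_form_word_prod:
  "ws \<in> reduced_words r \<Longrightarrow> normal_form (word_prod G (map (letter G s) ws)) = ws"
  using free the_inv_into_f_f[of "\<lambda>ws. word_prod G (map (letter G s) ws)" "reduced_words r" ws]
  by (simp add: normal_form_def free_group_on_def bij_betw_def)

lemma normal_form_one: "normal_form \<one> = []"
  using normal_form_word_prod[of "[]"] by (simp add: reduced_words_def word_prod_def)

definition starts_with :: "nat \<times> bool \<Rightarrow> 'g \<Rightarrow> bool" where
  "starts_with l g \<longleftrightarrow> (\<exists>ws. normal_form g = l # ws)"

lemma starts_with_unique: "starts_with l g \<Longrightarrow> starts_with l' g \<Longrightarrow> l = l'"
  by (auto simp: starts_with_def)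

lemma starts_with_inv_gen:
  assumes g: "g \<in> carrier G" and i: "i \<in> {1..r}" and "\<not> starts_with (i, True) g"
  shows "starts_with (i, False) (inv (s i) \<otimes> g)"
proof -
  let ?ws = "(i, False) # normal_form g"
  have "?ws \<in> reduced_words r"
    using normal_form(1)[OF g] i assms(3)
    by (cases "normal_form g") (auto simp: reduced_words_def starts_with_def)
  from normal_form_word_prod[OF this] have "normal_form (inv (s i) \<otimes> g) = ?ws"
    using normal_form(2)[OF g] by (simp add: word_prod_def letter_def)
  then show ?thesis by (simp add: starts_with_def)
qed

text \<open>
  The sum counts the edges between \<open>inv (s i) \<otimes> g\<close> and \<open>g\<close> of the Cayley graph that lie in \<open>W\<close>. The
  graph is a tree, so a finite vertex set spans fewer edges than it has vertices. Concretely, every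
  edge is sent to its endpoint farther from the identity, whose first letter determines the edge;
  the identity is never hit.
\<close>

lemma sum_card_edges_less:
  assumes W: "finite W" "W \<subseteq> carrier G" and "\<one> \<in> W"
  shows "(\<Sum>i=1..r. card (W \<inter> (\<lambda>g. s i \<otimes> g) ` W)) < card W"
proof -
  define E where "E = (SIGMA i:{1..r}. W \<inter> (\<lambda>g. s i \<otimes> g) ` W)"
  define tip where "tip = (\<lambda>(i, g). if starts_with (i, True) g then g else inv (s i) \<otimes> g)"
  have E: "i \<in> {1..r}" "s i \<in> carrier G" "g \<in> carrier G" "g \<in> W" "inv (s i) \<otimes> g \<in> W"
    if e: "(i, g) \<in> E" for i g
  proof -
    show i: "i \<in> {1..r}" and gW: "g \<in> W" using e by (auto simp: E_def)
    show si: "s i \<in> carrier G" using gen_closed[OF i] .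
    show "g \<in> carrier G" using gW W by auto
    obtain h where "h \<in> W" "g = s i \<otimes> h" using e by (auto simp: E_def)
    then show "inv (s i) \<otimes> g \<in> W" using si W(2) by (auto simp: m_assoc[symmetric])
  qed
  have start: "starts_with (i, starts_with (i, True) g) (tip (i, g))" if "(i, g) \<in> E" for i g
    using starts_with_inv_gen[OF E(3,1)[OF that]] by (auto simp: tip_def)
  have "card E \<le> card (W - {\<one>})"
  proof (rule card_inj_on_le)
    show "inj_on tip E"
    proof (rule inj_onI, clarify)
      fix i g j h assume e: "(i, g) \<in> E" "(j, h) \<in> E" and eq: "tip (i, g) = tip (j, h)"
      have "i = j \<and> starts_with (i, True) g = starts_with (j, True) h"
        using starts_with_unique[OF start[OF e(1)]] start[OF e(2)] eq by auto
      then show "i = j \<and> g = h"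
        using eq E[OF e(1)] E[OF e(2)] by (auto simp: tip_def split: if_splits)
    qed
    show "tip ` E \<subseteq> W - {\<one>}"
    proof (rule image_subsetI)
      fix e assume "e \<in> E"
      then obtain i g where e: "e = (i, g)" "(i, g) \<in> E" by (cases e) auto
      have "tip e \<noteq> \<one>" using start[OF e(2)] e(1) by (auto simp: starts_with_def normal_form_one)
      then show "tip e \<in> W - {\<one>}" using E[OF e(2)] e(1) by (auto simp: tip_def)
    qed
    show "finite (W - {\<one>})" using W by simp
  qed
  also have "\<dots> < card W" using W assms(3) by (intro psubset_card_mono) auto
  also have "card E = (\<Sum>i=1..r. card (W \<inter> (\<lambda>g. s i \<otimes> g) ` W))"
    unfolding E_def using W by (intro card_SigmaI) auto
  finally show ?thesis by simp
qed

lemma F_agree_on: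
  assumes W: "finite W" "W \<subseteq> carrier G"
  shows "F (agree_on W)
    = (real (card W) - real (\<Sum>i=1..r. card (W \<inter> (\<lambda>g. s i \<otimes> g) ` W))) * base_entropy K \<kappa>"
proof -
  have "equiv_entropy \<mu> (agree_on W \<inter> shift_rel (s i) (agree_on W))
      = (2 * real (card W) - real (card (W \<inter> (\<lambda>g. s i \<otimes> g) ` W))) * base_entropy K \<kappa>"
    if i: "i \<in> {1..r}" for i
  proof -
    note si = gen_closed[OF i]
    let ?V = "(\<lambda>g. s i \<otimes> g) ` W"
    have V: "?V \<subseteq> carrier G" "finite ?V" using W si by auto
    have "shift_rel (s i) (agree_on W) = agree_on ?V"
    proof -
      have "shift_rel (s i) (agree_on W) = refine (refine (agree_on {\<one>}) W) {s i}"
        by (auto simp: refine_agree_on[OF W(2)] refine_insert refine_empty shift_rel_def)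
      also have "\<dots> = refine (agree_on {\<one>}) ?V"
        using si W by (subst refine_refine) (auto intro!: arg_cong[where f = "refine _"])
      also have "\<dots> = agree_on ?V" by (rule refine_agree_on[OF V(1)])
      finally show ?thesis .
    qed
    then have "agree_on W \<inter> shift_rel (s i) (agree_on W) = agree_on (W \<union> ?V)"
      by (auto simp: agree_on_def)
    moreover have "real (card (W \<union> ?V)) = 2 * real (card W) - real (card (W \<inter> ?V))"
    proof -
      have "inj_on (\<lambda>g. s i \<otimes> g) W" using W(2) si by (intro inj_onI) (metis Units_eq Units_l_cancel subsetD)
      then have "card ?V = card W" by (rule card_image)
      then show ?thesis using card_Un_Int[OF W(1) V(2)] by linarith
    qed
    ultimately show ?thesis using equiv_entropy_agree_on[of "W \<union> ?V"] W V by simp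
  qed
  then have "(\<Sum>i=1..r. equiv_entropy \<mu> (agree_on W \<inter> shift_rel (s i) (agree_on W)))
      = (\<Sum>i=1..r. 2 * real (card W) - real (card (W \<inter> (\<lambda>g. s i \<otimes> g) ` W))) * base_entropy K \<kappa>"
    unfolding sum_distrib_right by (intro sum.cong refl)
  then show ?thesis
    unfolding F_def equiv_entropy_agree_on[OF W] by (simp add: sum_subtractf algebra_simps)
qed

lemma base_entropy_nonneg: "0 \<le> base_entropy K \<kappa>"
proof -
  have "measure \<kappa> {k} * ln (measure \<kappa> {k}) \<le> 0" for k
  proof (cases "measure \<kappa> {k} = 0")
    case False
    then have "0 < measure \<kappa> {k}" by (simp add: less_le)
    then show ?thesis
      using prob_space.prob_le_1[OF prob_space_base] by (intro mult_nonneg_nonpos) auto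
  qed simp
  then show ?thesis unfolding base_entropy_def by (simp add: sum_nonpos)
qed

lemma f_partition_canonical: "f_partition G r s \<mu> T canonical_partition = ereal (base_entropy K \<kappa>)"
proof -
  have F: "F (refine (agree_on {\<one>}) (ball n)) = (real (card (ball n))
      - real (\<Sum>i=1..r. card (ball n \<inter> (\<lambda>g. s i \<otimes> g) ` ball n))) * base_entropy K \<kappa>" for n
    by (simp add: refine_agree_on[OF ball_closed] F_agree_on[OF finite_ball ball_closed])
  have "f_rel (agree_on {\<one>}) = ereal (base_entropy K \<kappa>)"
  proof (rule antisym)
    have "f_rel (agree_on {\<one>}) \<le> ereal (F (refine (agree_on {\<one>}) (ball 0)))"
      unfolding f_rel_def by (intro INF_lower) simp
    also have "\<dots> \<le> ereal (1 * base_entropy K \<kappa>)"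
      unfolding F by (intro ereal_less_eq(3)[THEN iffD2] mult_right_mono base_entropy_nonneg) (simp add: ball_0 sum_nonneg)
    finally show "f_rel (agree_on {\<one>}) \<le> ereal (base_entropy K \<kappa>)" by simp
    have "1 * base_entropy K \<kappa> \<le> F (refine (agree_on {\<one>}) (ball n))" for n
      unfolding F using sum_card_edges_less[OF finite_ball ball_closed one_in_ball, of n]
      by (intro mult_right_mono base_entropy_nonneg) linarith
    then show "ereal (base_entropy K \<kappa>) \<le> f_rel (agree_on {\<one>})"
      unfolding f_rel_def by (intro INF_greatest) simp
  qed
  then show ?thesis
    by (simp add: f_partition_same_cell[OF finite_partition_canonical] same_cell_canonical)
qed

end

theorem theorem5p2:
  fixes G :: "('g, 'm) monoid_scheme" and r :: nat and s :: "nat \<Rightarrow> 'g"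
    and K :: "'k set" and \<kappa> :: "'k measure"
  assumes "free_group_on G r s"
    and "finite K"
    and "prob_space \<kappa>" and "space \<kappa> = K" and "sets \<kappa> = Pow K"
  shows "f_invariant G r s (bernoulli_measure G \<kappa>) (bernoulli_shift G) = ereal (base_entropy K \<kappa>)"
proof -
  interpret free_bernoulli G r s K \<kappa>
    using assms by (intro free_bernoulli.intro)
  show ?thesis using f_invariant_eq[OF generating_canonical] f_partition_canonical by simp
qed

end
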